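(* Let $a>-1$, $|b|<1$, $|b|<1+a$ and let $f\in C^1(\mathbb R)$. Then the generalized quadratic covariation $[f(B^{a,b}),B^{a,b}]^{(a,b)}$ exists and $$[f(B^{a,b}),B^{a,b}]^{(a,b)}_t=\kappa_{a,b}\int_0^tf'(B^{a,b}_s)\,ds^{1+a+b},\qquad t\ge 0,$$ where $\kappa_{a,b}=\dfrac1{(1+b)\mathbb B(a+1,b+1)}$ and $ds^{1+a+b}=(1+a+b)s^{a+b}ds$.
   Context: For $a>-1$, $|b|<1$, $|b|<a+1$, the weighted fractional Brownian motion $B^{a,b}=(B^{a,b}_t)_{t\ge 0}$ is a continuous centered Gaussian process with $B^{a,b}_0=0$ and covariance $$E[B^{a,b}_tB^{a,b}_s]=\frac{1}{2\mathbb B(a+1,b+1)}\int_0^{s\wedge t}u^a\big((t-u)^b+(s-u)^b\big)\,du,$$ where $\mathbb B(\cdot,\cdot)$ is the Beta function. (The paper assumes $b\ne0$ throughout for simplicity.) For a Borel function $f$ and $\varepsilon>0$ put $$J_\varepsilon(f,t)=\frac{1+a+b}{\varepsilon^{1+b}}\int_\varepsilon^{t+\varepsilon}\{f(B^{a,b}_{s+\varepsilon})-f(B^{a,b}_s)\}(B^{a,b}_{s+\varepsilon}-B^{a,b}_s)s^b\,ds .$$ The generalized quadratic covariation is $[f(B^{a,b}),B^{a,b}]^{(a,b)}_t=\lim_{\varepsilon\downarrow0}J_\varepsilon(f,t)$, provided the limit exists uniformly in probability (uniformly in $t$ on compact intervals, in probability). *)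

theory Defs
  imports "HOL-Probability.Probability"
begin

text \<open>
  Stochastic processes are functions \<open>X :: real \<Rightarrow> 'a \<Rightarrow> real\<close> (time, then sample point)
  on a probability space \<open>M\<close>; only times \<open>t \<ge> 0\<close> are constrained.
\<close>

text \<open>The second disjunct is the degenerate Gaussian law (variance zero).\<close>

definition gaussian_rv :: "'a measure \<Rightarrow> ('a \<Rightarrow> real) \<Rightarrow> bool" where
  "gaussian_rv M X \<longleftrightarrow>
     X \<in> borel_measurable M \<and>
     ((\<exists>\<mu> \<sigma>. \<sigma> > 0 \<and> distributed M lborel X (normal_density \<mu> \<sigma>)) \<or>
      (\<exists>\<mu>. AE \<omega> in M. X \<omega> = \<mu>))"

definition gaussian_process :: "'a measure \<Rightarrow> (real \<Rightarrow> 'a \<Rightarrow> real) \<Rightarrow> bool" where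
  "gaussian_process M X \<longleftrightarrow>
     (\<forall>I c. finite I \<and> I \<subseteq> {0..} \<longrightarrow> gaussian_rv M (\<lambda>\<omega>. \<Sum>t\<in>I. c t * X t \<omega>))"

definition weighted_fbm :: "'a measure \<Rightarrow> real \<Rightarrow> real \<Rightarrow> (real \<Rightarrow> 'a \<Rightarrow> real) \<Rightarrow> bool" where
  "weighted_fbm M a b B \<longleftrightarrow>
     gaussian_process M B \<and>
     (\<forall>\<omega>\<in>space M. continuous_on {0..} (\<lambda>t. B t \<omega>)) \<and>
     (\<forall>\<omega>\<in>space M. B 0 \<omega> = 0) \<and>
     (\<forall>t\<ge>0. prob_space.expectation M (B t) = 0) \<and>
     (\<forall>t\<ge>0. \<forall>s\<ge>0. prob_space.expectation M (\<lambda>\<omega>. B t \<omega> * B s \<omega>) =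
        1 / (2 * Beta (a + 1) (b + 1)) *
        (LBINT u:{0..min s t}. u powr a * ((t - u) powr b + (s - u) powr b)))"

definition J_eps ::
  "real \<Rightarrow> real \<Rightarrow> (real \<Rightarrow> 'a \<Rightarrow> real) \<Rightarrow> real \<Rightarrow> (real \<Rightarrow> real) \<Rightarrow> real \<Rightarrow> 'a \<Rightarrow> real" where
  "J_eps a b B \<epsilon> f t \<omega> =
     (1 + a + b) / \<epsilon> powr (1 + b) *
     (LBINT s:{\<epsilon>..t + \<epsilon>}.
        (f (B (s + \<epsilon>) \<omega>) - f (B s \<omega>)) * (B (s + \<epsilon>) \<omega> - B s \<omega>) * s powr b)"

text \<open>
  Uniform convergence in probability on compact time intervals, as \<open>\<epsilon>\<close> decreases to \<open>0\<close>.
  The event is \<open>sup\<^sub>t\<^sub>\<le>\<^sub>T \<bar>X\<^sub>\<epsilon> t - Y t\<bar> > \<delta>\<close>, written without \<open>Sup\<close> because a real supremum is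
  unspecified for unbounded sets.  Its measurability is required explicitly, since
  \<^const>\<open>measure\<close> is \<open>0\<close> on non-measurable sets.
\<close>

definition ucp_limit ::
  "'a measure \<Rightarrow> (real \<Rightarrow> real \<Rightarrow> 'a \<Rightarrow> real) \<Rightarrow> (real \<Rightarrow> 'a \<Rightarrow> real) \<Rightarrow> bool" where
  "ucp_limit M X Y \<longleftrightarrow>
     (\<forall>T\<ge>0. \<forall>\<delta>>0.
        (\<forall>\<^sub>F \<epsilon> in at_right 0. {\<omega> \<in> space M. \<exists>t\<in>{0..T}. \<bar>X \<epsilon> t \<omega> - Y t \<omega>\<bar> > \<delta>} \<in> sets M) \<and>
        ((\<lambda>\<epsilon>. measure M {\<omega> \<in> space M. \<exists>t\<in>{0..T}. \<bar>X \<epsilon> t \<omega> - Y t \<omega>\<bar> > \<delta>}) \<longlongrightarrow> 0)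
          (at_right 0))"

text \<open>
  \<open>has_gen_quad_covariation M a b B f Q\<close>: the generalized quadratic covariation
  \<open>[f(B), B]\<^sup>(\<^sup>a\<^sup>,\<^sup>b\<^sup>)\<close> exists and is the process \<open>Q\<close>.  A relation is used because a limit in
  probability is determined only up to null sets.
\<close>

definition has_gen_quad_covariation ::
  "'a measure \<Rightarrow> real \<Rightarrow> real \<Rightarrow> (real \<Rightarrow> 'a \<Rightarrow> real) \<Rightarrow> (real \<Rightarrow> real) \<Rightarrow>
   (real \<Rightarrow> 'a \<Rightarrow> real) \<Rightarrow> bool" where
  "has_gen_quad_covariation M a b B f Q \<longleftrightarrow> ucp_limit M (\<lambda>\<epsilon> t \<omega>. J_eps a b B \<epsilon> f t \<omega>) Q"

definition kappa :: "real \<Rightarrow> real \<Rightarrow> real" where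
  "kappa a b = 1 / ((1 + b) * Beta (a + 1) (b + 1))"

end

theory Submission
  imports Defs
begin

text \<open>
  Substituting \<open>s + \<epsilon>\<close> for \<open>s\<close> turns \<open>J\<^sub>\<epsilon>(f, t)\<close> into an integral over the fixed interval \<open>[0, t]\<close>.
  For \<open>f = id\<close> its integrand is the nonnegative function
  \[ H_\epsilon(s) = (1 + a + b)\, \epsilon^{-1-b} (B_{s+2\epsilon} - B_{s+\epsilon})^2 (s + \epsilon)^b , \]
  called \<open>qv_density\<close> below.  For \<open>f \<in> C\<^sup>1\<close> the mean value theorem and the uniform continuity of the
  path give \<open>J\<^sub>\<epsilon>(f, t) = \<integral>\<^sub>0\<^sup>t f'(B\<^sub>s) H\<^sub>\<epsilon>(s) ds\<close> up to an error \<open>\<eta> \<integral>\<^sub>0\<^sup>T H\<^sub>\<epsilon>\<close> with \<open>\<eta>\<close> arbitrarily small,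
  uniformly in \<open>t \<le> T\<close>.  The claim thus says that the random measures \<open>H\<^sub>\<epsilon>(s) ds\<close> converge weakly to
  the deterministic measure \<open>h(s) ds\<close>, \<open>h(s) = \<kappa> (1 + a + b) s\<^sup>a\<^sup>+\<^sup>b\<close> (\<open>limit_density\<close>), and it has a
  probabilistic half and a pathwise half.

  Probability: \<open>\<integral>\<^sub>0\<^sup>t H\<^sub>\<epsilon> \<longrightarrow> \<integral>\<^sub>0\<^sup>t h\<close> in \<open>L\<^sup>2\<close> for each fixed \<open>t\<close> (\<open>qv_density_integral_L2_tendsto\<close>).  The
  covariance of \<open>B\<close> yields
  \[ E (B_t - B_s)^2 = \frac{1}{\mathbb{B}(a+1, b+1)} \int_s^t u^a (t - u)^b\, du , \]
  which is \<open>\<kappa> s\<^sup>a \<epsilon>\<^sup>1\<^sup>+\<^sup>b\<close> to first order when \<open>t = s + \<epsilon>\<close>, so that \<open>E H\<^sub>\<epsilon>(s) \<longrightarrow> h(s)\<close>.  For centred jointly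
  Gaussian \<open>X, Y\<close> one has \<open>E X\<^sup>2 Y\<^sup>2 = E X\<^sup>2 E Y\<^sup>2 + 2 (E X Y)\<^sup>2\<close>, and two increments of length \<open>\<epsilon>\<close> at
  distinct times have covariance \<open>O(\<epsilon>\<^sup>2)\<close>, which is negligible against \<open>\<epsilon>\<^sup>1\<^sup>+\<^sup>b\<close> because \<open>b < 1\<close>.  Hence
  \<open>E H\<^sub>\<epsilon>(s) H\<^sub>\<epsilon>(r) \<longrightarrow> h(s) h(r)\<close> off the diagonal.  The shift by \<open>\<epsilon>\<close> keeps the increments away from
  time \<open>0\<close>, so \<open>E H\<^sub>\<epsilon>(s)\<close> is bounded by a multiple of \<open>(s + \<epsilon>)\<^sup>a\<^sup>+\<^sup>b\<close>, which has an integrable majorant,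
  and by Cauchy-Schwarz \<open>E H\<^sub>\<epsilon>(s) H\<^sub>\<epsilon>(r) \<le> 3 E H\<^sub>\<epsilon>(s) E H\<^sub>\<epsilon>(r)\<close>.  Dominated convergence does the rest.

  Paths: if nonnegative densities \<open>H\<^sub>n\<close> satisfy \<open>\<integral>\<^sub>0\<^sup>q H\<^sub>n \<longrightarrow> \<integral>\<^sub>0\<^sup>q h\<close> on the rational grid of \<open>[0, T]\<close>, then
  \<open>\<integral>\<^sub>0\<^sup>t g H\<^sub>n \<longrightarrow> \<integral>\<^sub>0\<^sup>t g h\<close> uniformly in \<open>t \<le> T\<close> for every continuous \<open>g\<close>
  (\<open>uniform_limit_weighted_integrals\<close>).

  The halves are joined by \<open>vanishing_probability_by_sequences\<close>: along a sequence \<open>\<epsilon>\<^sub>n\<close> chosen fast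
  enough for Borel-Cantelli, the \<open>L\<^sup>2\<close> convergence holds almost surely at all grid points at once,
  where the pathwise half applies.
\<close>

section \<open>Integrals over compact intervals\<close>

lemma set_lborel_integral_Icc_split:
  fixes f :: "real \<Rightarrow> real"
  assumes "p \<le> q" "q \<le> r" "set_integrable lborel {p..r} f"
  shows "(LBINT u:{p..r}. f u) = (LBINT u:{p..q}. f u) + (LBINT u:{q..r}. f u)"
proof -
  have "set_integrable lborel {p..q} f" "set_integrable lborel {q..r} f"
    using assms by (auto intro: set_integrable_subset[OF assms(3)])
  moreover have "AE x in lborel. \<not> (x \<in> {p..q} \<and> x \<in> {q..r})"
    using AE_lborel_singleton[of q] by eventually_elim auto
  moreover have "{p..r} = {p..q} \<union> {q..r}" using assms(1,2) by auto
  ultimately show ?thesis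
    by (simp add: set_integral_Un_AE)
qed

lemma set_lborel_integral_singleton:
  fixes f :: "real \<Rightarrow> real"
  shows "(LBINT s:{p}. f s) = 0"
proof -
  have "AE s in lborel. indicator {p} s *\<^sub>R f s = 0"
    using AE_lborel_singleton[of p] by eventually_elim auto
  then show ?thesis unfolding set_lebesgue_integral_def by (rule integral_eq_zero_AE)
qed

lemma set_lborel_integral_continuous_upper:
  fixes k :: "real \<Rightarrow> real"
  assumes "set_integrable lborel {p..q} k"
  shows "continuous_on {p..q} (\<lambda>t. LBINT s:{p..t}. k s)"
proof (rule continuous_on_eq)
  show "continuous_on {p..q} (\<lambda>t. integral {p..t} k)"
    by (rule indefinite_integral_continuous_1[OF set_borel_integral_eq_integral(1)[OF assms]])
  fix t assume "t \<in> {p..q}"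
  then have "set_integrable lborel {p..t} k" by (intro set_integrable_subset[OF assms]) auto
  then show "integral {p..t} k = (LBINT s:{p..t}. k s)"
    by (rule set_borel_integral_eq_integral(2)[symmetric])
qed

lemma continuous_times_set_integrable:
  fixes g H :: "real \<Rightarrow> real"
  assumes g: "continuous_on {p..q} g" and H: "set_integrable lborel {p..q} H"
  shows "set_integrable lborel {p..q} (\<lambda>s. g s * H s)"
proof -
  have "compact (g ` {p..q})" using g by (intro compact_continuous_image) auto
  then obtain G where "\<forall>y\<in>g ` {p..q}. norm y \<le> G" using compact_imp_bounded bounded_iff by metis
  then have G: "\<And>s. s \<in> {p..q} \<Longrightarrow> \<bar>g s\<bar> \<le> G" by auto
  have H': "integrable lborel (\<lambda>s. indicator {p..q} s *\<^sub>R H s)" using H by (simp add: set_integrable_def)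
  have g': "(\<lambda>s. indicator {p..q} s *\<^sub>R g s) \<in> borel_measurable lborel"
    using borel_measurable_continuous_on_indicator[OF _ g] by simp
  have "integrable lborel (\<lambda>s. (indicator {p..q} s *\<^sub>R g s) * (indicator {p..q} s *\<^sub>R H s))"
  proof (rule Bochner_Integration.integrable_bound)
    show "integrable lborel (\<lambda>s. G * (indicator {p..q} s *\<^sub>R H s))" using H' by (rule integrable_mult_right)
    show "(\<lambda>s. (indicator {p..q} s *\<^sub>R g s) * (indicator {p..q} s *\<^sub>R H s)) \<in> borel_measurable lborel"
      using g' borel_measurable_integrable[OF H'] by (rule borel_measurable_times)
    show "AE s in lborel. norm ((indicator {p..q} s *\<^sub>R g s) * (indicator {p..q} s *\<^sub>R H s))
        \<le> norm (G * (indicator {p..q} s *\<^sub>R H s))"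
      using G by (intro AE_I2) (force simp: indicator_def abs_mult intro!: mult_right_mono)
  qed
  also have "(\<lambda>s. (indicator {p..q} s *\<^sub>R g s) * (indicator {p..q} s *\<^sub>R H s)) =
      (\<lambda>s. indicator {p..q} s *\<^sub>R (g s * H s))" by (auto simp: indicator_def)
  finally show ?thesis by (simp add: set_integrable_def)
qed

section \<open>Power functions and the Beta kernel\<close>

text \<open>
  The substitution \<open>u = t v\<close> reduces this to the convergence of the Beta integral.
\<close>

lemma powr_kernel_set_integrable:
  fixes a b t :: real
  assumes "a > -1" "b > -1" "t \<ge> 0"
  shows "set_integrable lborel {0..t} (\<lambda>u. u powr a * (t - u) powr b)"
proof (cases "t = 0")
  case True
  have "(\<lambda>u. indicator {0..0::real} u *\<^sub>R (u powr a * (0 - u) powr b)) = (\<lambda>_. 0)"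
    by (auto simp: indicator_def)
  then show ?thesis using True by (simp add: set_integrable_def)
next
  case False
  then have t: "t > 0" using assms by simp
  have "integrable lborel (\<lambda>v. indicator {0..1} v *\<^sub>R (v powr a * (1 - v) powr b))"
    using integrable_Beta[of "a + 1" "b + 1"] assms by (simp add: set_integrable_def)
  then have "integrable lborel (\<lambda>v. t powr (a + b) * (indicator {0..1} v *\<^sub>R (v powr a * (1 - v) powr b)))"
    by (rule integrable_mult_right)
  also have "(\<lambda>v. t powr (a + b) * (indicator {0..1} v *\<^sub>R (v powr a * (1 - v) powr b)))
    = (\<lambda>v. indicator {0..t} (0 + t * v) *\<^sub>R ((0 + t * v) powr a * (t - (0 + t * v)) powr b))"
  proof
    fix v :: real
    have "indicator {0..t} (t * v) = (indicator {0..1} v :: real)"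
      using t by (auto simp: indicator_def zero_le_mult_iff)
    moreover have "t - t * v = t * (1 - v)" by (simp add: algebra_simps)
    ultimately show "t powr (a + b) * (indicator {0..1} v *\<^sub>R (v powr a * (1 - v) powr b))
      = indicator {0..t} (0 + t * v) *\<^sub>R ((0 + t * v) powr a * (t - (0 + t * v)) powr b)"
      using t by (cases "v \<in> {0..1}") (auto simp: powr_mult powr_add)
  qed
  finally show ?thesis
    using lborel_integrable_real_affine_iff[of t "\<lambda>u. indicator {0..t} u *\<^sub>R (u powr a * (t - u) powr b)" 0] t
    by (simp add: set_integrable_def)
qed

text \<open>
  The case \<open>b = 0\<close> of the kernel above, up to the null set \<open>{t}\<close>, where \<open>0 powr 0 = 0\<close>.
\<close>

lemma powr_set_integrable:
  fixes a t :: real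
  assumes "a > -1"
  shows "set_integrable lborel {0..t} (\<lambda>u. u powr a)"
proof (cases "t \<ge> 0")
  case True
  have "set_integrable lborel {0..t} (\<lambda>u. u powr a * (t - u) powr 0)"
    by (rule powr_kernel_set_integrable) (use assms True in auto)
  moreover have "AE u in lborel. u \<in> {0..t} \<longrightarrow> u powr a * (t - u) powr 0 = u powr a"
    using AE_lborel_singleton[of t] by eventually_elim auto
  ultimately show ?thesis
    by (subst (asm) set_integrable_cong_AE[where g = "\<lambda>u. u powr a"]) auto
qed simp

lemma powr_set_integral:
  fixes a t :: real
  assumes "a > -1" "t \<ge> 0"
  shows "(LBINT u:{0..t}. u powr a) = t powr (a + 1) / (a + 1)"
  using set_borel_integral_eq_integral(2)[OF powr_set_integrable[OF assms(1), of t]]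
    integral_unique[OF has_integral_powr_from_0[OF assms]] by simp

lemma reflected_powr_set_integral:
  fixes b s t :: real
  assumes "b > -1" "s \<le> t"
  shows reflected_powr_set_integrable: "set_integrable lborel {s..t} (\<lambda>u. (t - u) powr b)"
    and "(LBINT u:{s..t}. (t - u) powr b) = (t - s) powr (b + 1) / (b + 1)"
proof -
  have eq: "(\<lambda>u. indicator {0..t - s} u * u powr b) = (\<lambda>u. indicator {s..t} (t - u) * u powr b)"
    by (auto simp: indicator_def fun_eq_iff)
  show "set_integrable lborel {s..t} (\<lambda>u. (t - u) powr b)"
    using powr_set_integrable[of b "t - s"] assms
      lborel_integrable_real_affine_iff[of "-1" "\<lambda>u. indicator {s..t} u *\<^sub>R (t - u) powr b" t]
    by (simp add: set_integrable_def eq)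
  show "(LBINT u:{s..t}. (t - u) powr b) = (t - s) powr (b + 1) / (b + 1)"
    using powr_set_integral[of b "t - s"] assms
      lborel_integral_real_affine[of "-1" "\<lambda>u. indicator {s..t} u *\<^sub>R (t - u) powr b" t]
    by (simp add: set_lebesgue_integral_def eq)
qed

lemma powr_between_endpoints:
  fixes a s t u :: real
  assumes "0 < s" "s \<le> u" "u \<le> t"
  shows "min (s powr a) (t powr a) \<le> u powr a" "u powr a \<le> max (s powr a) (t powr a)"
proof -
  have "s powr a \<le> u powr a \<and> u powr a \<le> t powr a \<or> t powr a \<le> u powr a \<and> u powr a \<le> s powr a"
  proof (cases "a \<ge> 0")
    case True then show ?thesis using assms by (auto intro!: powr_mono2)
  next
    case False then show ?thesis using assms by (auto intro!: powr_mono2')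
  qed
  then show "min (s powr a) (t powr a) \<le> u powr a" "u powr a \<le> max (s powr a) (t powr a)" by auto
qed

text \<open>
  The mean value theorem, with \<open>\<bar>b\<bar> < 1\<close> used twice: it bounds the factor \<open>b\<close> of the derivative and
  makes \<open>z \<mapsto> z powr (b - 1)\<close> decreasing.
\<close>

lemma powr_difference_bound:
  fixes b d x \<epsilon> :: real
  assumes "\<bar>b\<bar> < 1" "0 < d" "d \<le> x" "0 < \<epsilon>"
  shows "\<bar>(x + \<epsilon>) powr b - x powr b\<bar> \<le> \<epsilon> * d powr (b - 1)"
proof -
  have "\<exists>z. x < z \<and> z < x + \<epsilon> \<and> (x + \<epsilon>) powr b - x powr b = (x + \<epsilon> - x) * (b * z powr (b - 1))"
    using assms by (intro MVT2) (auto intro!: derivative_eq_intros simp: powr_diff)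
  then obtain z where z: "x < z" "(x + \<epsilon>) powr b - x powr b = \<epsilon> * (b * z powr (b - 1))" by auto
  have "\<bar>b * z powr (b - 1)\<bar> \<le> 1 * z powr (b - 1)"
    unfolding abs_mult using assms by (intro mult_mono) auto
  also have "\<dots> \<le> d powr (b - 1)"
    using assms z by (auto intro!: powr_mono2')
  finally show ?thesis using z(2) assms by (simp add: abs_mult)
qed

lemma Beta_real_pos: "x > 0 \<Longrightarrow> y > 0 \<Longrightarrow> Beta x y > (0::real)"
  by (simp add: Beta_altdef rGamma_inverse_Gamma Gamma_real_pos)

section \<open>Weak convergence of nonnegative densities\<close>

text \<open>
  Taking the least admissible \<open>i\<close> avoids dividing by \<open>T\<close>, which may be \<open>0\<close>.
\<close>

lemma grid_cell:
  fixes T t :: real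
  assumes "0 \<le> T" "0 < m" "t \<in> {0..T}"
  shows "\<exists>i<m. T * real i / real m \<le> t \<and> t \<le> T * real (Suc i) / real m"
proof -
  define i where "i = (LEAST i. t \<le> T * real (Suc i) / real m)"
  have last: "t \<le> T * real (Suc (m - 1)) / real m" using assms by simp
  have up: "t \<le> T * real (Suc i) / real m" unfolding i_def using last by (rule LeastI)
  have "i \<le> m - 1" unfolding i_def using last by (rule Least_le)
  moreover have "T * real i / real m \<le> t"
  proof (cases i)
    case 0 then show ?thesis using assms by simp
  next
    case (Suc j)
    then have "\<not> t \<le> T * real (Suc j) / real m"
      unfolding i_def by (intro not_less_Least) auto
    then show ?thesis using Suc by simp
  qed
  ultimately show ?thesis using up assms by (intro exI[of _ i]) auto
qed

lemma grid_points_le: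
  fixes T :: real
  assumes "0 \<le> T" "i \<le> m" "0 < m"
  shows "T * real i / real m \<in> {0..T}"
  using assms by (auto simp: field_simps intro!: mult_left_mono)

lemma continuous_on_fine_grid:
  fixes g :: "real \<Rightarrow> real"
  assumes "0 \<le> T" "continuous_on {0..T} g" "\<eta> > 0"
  obtains m where "m > 0"
    "\<And>i s t. \<lbrakk>i < m; s \<in> {T * real i / real m..T * real (Suc i) / real m};
        t \<in> {T * real i / real m..T * real (Suc i) / real m}\<rbrakk> \<Longrightarrow> \<bar>g s - g t\<bar> < \<eta>"
proof -
  have "uniformly_continuous_on {0..T} g"
    using assms by (intro compact_uniformly_continuous) auto
  then obtain d where d: "d > 0" "\<And>s t. s \<in> {0..T} \<Longrightarrow> t \<in> {0..T} \<Longrightarrow> \<bar>s - t\<bar> < d \<Longrightarrow> \<bar>g s - g t\<bar> < \<eta>"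
    using assms(3) unfolding uniformly_continuous_on_def dist_real_def by metis
  obtain m where m: "T / d < real m" using reals_Archimedean2 by blast
  have "0 \<le> T / d" using assms d by simp
  with m have m0: "0 < real m" by linarith
  have mesh: "T / real m < d" using m m0 d by (simp add: field_simps)
  show thesis
  proof
    show "m > 0" using m0 by simp
    fix i s t
    assume i: "i < m" and s: "s \<in> {T * real i / real m..T * real (Suc i) / real m}"
      and t: "t \<in> {T * real i / real m..T * real (Suc i) / real m}"
    have "T * real (Suc i) / real m \<le> T" "0 \<le> T * real i / real m"
      using grid_points_le[OF assms(1), of "Suc i" m] grid_points_le[OF assms(1), of i m] i by auto
    moreover have "T * real (Suc i) / real m = T * real i / real m + T / real m"
      by (simp add: add_divide_distrib distrib_left)
    ultimately show "\<bar>g s - g t\<bar> < \<eta>" using s t mesh by (intro d(2)) auto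
  qed
qed

text \<open>
  Polya's argument: on a cell \<open>[p, q]\<close> of a grid on which the limit oscillates little, monotonicity
  squeezes \<open>Z\<^sub>n t\<close> between \<open>Z\<^sub>n p\<close> and \<open>Z\<^sub>n q\<close>, which are close to the limit at \<open>p\<close> and \<open>q\<close>.
\<close>

lemma monotone_grid_convergence_uniform:
  fixes Z :: "nat \<Rightarrow> real \<Rightarrow> real" and F :: "real \<Rightarrow> real"
  assumes T: "0 \<le> T"
    and mono: "\<And>n. mono_on {0..T} (Z n)"
    and F: "continuous_on {0..T} F"
    and conv: "\<And>i m. i \<le> m \<Longrightarrow> 0 < m \<Longrightarrow> (\<lambda>n. Z n (T * real i / real m)) \<longlonglongrightarrow> F (T * real i / real m)"
  shows "uniform_limit {0..T} Z F sequentially"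
proof (rule uniform_limitI)
  fix e :: real assume e: "e > 0"
  obtain m where m: "m > 0"
    "\<And>i s t. \<lbrakk>i < m; s \<in> {T * real i / real m..T * real (Suc i) / real m};
        t \<in> {T * real i / real m..T * real (Suc i) / real m}\<rbrakk> \<Longrightarrow> \<bar>F s - F t\<bar> < e / 2"
    using continuous_on_fine_grid[OF T F, of "e / 2"] e by auto
  have "\<forall>\<^sub>F n in sequentially. \<forall>i\<in>{..m}. \<bar>Z n (T * real i / real m) - F (T * real i / real m)\<bar> < e / 2"
  proof (rule eventually_ball_finite)
    show "\<forall>i\<in>{..m}. \<forall>\<^sub>F n in sequentially. \<bar>Z n (T * real i / real m) - F (T * real i / real m)\<bar> < e / 2"
      using tendstoD[OF conv[OF _ m(1)], of _ "e / 2"] e by (auto simp: dist_real_def)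
  qed simp
  then show "\<forall>\<^sub>F n in sequentially. \<forall>t\<in>{0..T}. dist (Z n t) (F t) < e"
  proof eventually_elim
    case (elim n)
    show ?case
    proof
      fix t assume t: "t \<in> {0..T}"
      obtain i where i: "i < m" "T * real i / real m \<le> t" "t \<le> T * real (Suc i) / real m"
        using grid_cell[OF T m(1) t] by auto
      let ?p = "T * real i / real m" and ?q = "T * real (Suc i) / real m"
      have "?p \<in> {0..T}" "?q \<in> {0..T}" using i m(1) by (intro grid_points_le T; simp)+
      then have "Z n ?p \<le> Z n t" "Z n t \<le> Z n ?q"
        using mono_onD[OF mono] t i by blast+
      moreover have "\<bar>Z n ?p - F ?p\<bar> < e / 2" "\<bar>Z n ?q - F ?q\<bar> < e / 2"
        using elim i(1) by (auto simp del: of_nat_Suc)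
      moreover have "\<bar>F ?p - F t\<bar> < e / 2" "\<bar>F ?q - F t\<bar> < e / 2"
        using order_trans[OF i(2,3)] i(2,3) by (intro m(2)[OF i(1)]; simp del: of_nat_Suc)+
      ultimately show "dist (Z n t) (F t) < e" unfolding dist_real_def by linarith
    qed
  qed
qed

text \<open>
  The cost of replacing a slowly varying weight by a constant; \<open>H\<close> must be nonnegative for the error
  to be controlled by the mass of \<open>H\<close>.
\<close>

lemma set_integral_freeze_factor:
  fixes g H :: "real \<Rightarrow> real"
  assumes g: "continuous_on {p..q} g" and H: "set_integrable lborel {p..q} H"
    and H0: "\<And>s. s \<in> {p..q} \<Longrightarrow> 0 \<le> H s" and c: "\<And>s. s \<in> {p..q} \<Longrightarrow> \<bar>g s - c\<bar> \<le> \<eta>"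
  shows "\<bar>(LBINT s:{p..q}. g s * H s) - c * (LBINT s:{p..q}. H s)\<bar> \<le> \<eta> * (LBINT s:{p..q}. H s)"
proof -
  note gH = continuous_times_set_integrable[OF g H]
  have "(LBINT s:{p..q}. g s * H s) \<le> (LBINT s:{p..q}. (c + \<eta>) * H s)"
    by (intro set_integral_mono gH set_integrable_mult_right H mult_right_mono H0) (use c in fastforce)+
  moreover have "(LBINT s:{p..q}. (c - \<eta>) * H s) \<le> (LBINT s:{p..q}. g s * H s)"
    by (intro set_integral_mono gH set_integrable_mult_right H mult_right_mono H0) (use c in fastforce)+
  ultimately show ?thesis
    by (simp only: set_integral_mult_right abs_le_iff) (simp add: algebra_simps)
qed

text \<open>
  Weak convergence of the measures \<open>H\<^sub>n(s) ds\<close>, in a form uniform in the upper limit.  The distribution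
  functions converge uniformly by \<open>monotone_grid_convergence_uniform\<close>.  On a grid of \<open>m\<close> cells the
  weight \<open>g\<close> is frozen at the left end of each cell: every cell contributes at most \<open>2 G \<delta>\<close> from the
  distance \<open>\<delta>\<close> of the distribution functions, where \<open>G\<close> bounds \<open>g\<close>, and freezing costs \<open>\<eta>\<close> times the
  total mass.  Since \<open>m\<close> is determined by \<open>\<eta>\<close>,
  the distance \<open>\<delta>\<close> can be chosen small against \<open>1 / m\<close>.
\<close>

lemma uniform_limit_weighted_integrals:
  fixes H :: "nat \<Rightarrow> real \<Rightarrow> real" and h g :: "real \<Rightarrow> real"
  assumes T: "0 \<le> T"
    and H: "\<And>n. set_integrable lborel {0..T} (H n)" "\<And>n s. s \<in> {0..T} \<Longrightarrow> 0 \<le> H n s"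
    and h: "set_integrable lborel {0..T} h" "\<And>s. s \<in> {0..T} \<Longrightarrow> 0 \<le> h s"
    and F: "continuous_on {0..T} (\<lambda>t. LBINT s:{0..t}. h s)"
    and g: "continuous_on {0..T} g"
    and conv: "\<And>i m. i \<le> m \<Longrightarrow> 0 < m \<Longrightarrow>
      (\<lambda>n. LBINT s:{0..T * real i / real m}. H n s) \<longlonglongrightarrow> (LBINT s:{0..T * real i / real m}. h s)"
  shows "uniform_limit {0..T} (\<lambda>n t. LBINT s:{0..t}. g s * H n s) (\<lambda>t. LBINT s:{0..t}. g s * h s) sequentially"
proof (rule uniform_limitI)
  fix e :: real assume e: "e > 0"
  define Z where "Z n t = (LBINT s:{0..t}. H n s)" for n t
  define F where "F t = (LBINT s:{0..t}. h s)" for t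
  have split: "(LBINT s:{0..t}. k s) = (LBINT s:{0..r}. k s) + (LBINT s:{r..t}. k s)"
    if "set_integrable lborel {0..T} k" "0 \<le> r" "r \<le> t" "t \<le> T" for k :: "real \<Rightarrow> real" and r t
    using that by (intro set_lborel_integral_Icc_split set_integrable_subset[OF that(1)]) auto
  have nonneg: "0 \<le> (LBINT s:{r..t}. k s)" if "\<And>s. s \<in> {0..T} \<Longrightarrow> 0 \<le> k s" "0 \<le> r" "t \<le> T"
    for k :: "real \<Rightarrow> real" and r t
    unfolding set_lebesgue_integral_def using that by (intro integral_nonneg_AE AE_I2) (auto simp: indicator_def)
  have monoZ: "mono_on {0..T} (Z n)" for n
  proof (rule mono_onI)
    fix r t assume "r \<in> {0..T}" "t \<in> {0..T}" "r \<le> t"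
    then show "Z n r \<le> Z n t"
      unfolding Z_def using split[OF H(1), where r = r and t = t] nonneg[OF H(2), where r = r and t = t] by simp
  qed
  have unif: "uniform_limit {0..T} Z F sequentially"
    using F conv by (intro monotone_grid_convergence_uniform T monoZ) (auto simp: Z_def F_def)
  have FT: "0 \<le> F T" unfolding F_def using nonneg[OF h(2)] T by simp
  have "compact (g ` {0..T})" using g by (intro compact_continuous_image) auto
  then obtain G0 where "\<forall>y\<in>g ` {0..T}. norm y \<le> G0" using compact_imp_bounded bounded_iff by metis
  then have G0: "\<And>s. s \<in> {0..T} \<Longrightarrow> \<bar>g s\<bar> \<le> G0" by auto
  define G where "G = max 1 G0"
  have G: "G > 0" "\<And>s. s \<in> {0..T} \<Longrightarrow> \<bar>g s\<bar> \<le> G" using G0 by (fastforce simp: G_def)+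
  \<comment> \<open>The two total masses add up to at most \<open>2 F T + 1\<close> once \<open>Z\<^sub>n\<close> is within \<open>1\<close> of \<open>F\<close>.\<close>
  define \<eta> where "\<eta> = e / (2 * (2 * F T + 1))"
  have \<eta>: "\<eta> > 0" using e FT by (simp add: \<eta>_def)
  obtain m where m: "m > 0"
    "\<And>i s t. \<lbrakk>i < m; s \<in> {T * real i / real m..T * real (Suc i) / real m};
        t \<in> {T * real i / real m..T * real (Suc i) / real m}\<rbrakk> \<Longrightarrow> \<bar>g s - g t\<bar> < \<eta>"
    using continuous_on_fine_grid[OF T g \<eta>] by auto
  define \<delta> where "\<delta> = min 1 (e / (8 * G * real m))"
  have \<delta>: "\<delta> > 0" using e G m(1) by (simp add: \<delta>_def)
  have "\<forall>\<^sub>F n in sequentially. \<forall>t\<in>{0..T}. dist (Z n t) (F t) < \<delta>"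
    by (rule uniform_limitD[OF unif \<delta>])
  then show "\<forall>\<^sub>F n in sequentially. \<forall>t\<in>{0..T}. dist (LBINT s:{0..t}. g s * H n s) (LBINT s:{0..t}. g s * h s) < e"
  proof eventually_elim
    case (elim n)
    then have Z: "\<bar>Z n t - F t\<bar> \<le> \<delta>" if "t \<in> {0..T}" for t
      using that by (fastforce simp: dist_real_def)
    define D where "D t = (LBINT s:{0..t}. g s * H n s) - (LBINT s:{0..t}. g s * h s)" for t
    note gH = continuous_times_set_integrable[OF g H(1)] and gh = continuous_times_set_integrable[OF g h(1)]
    \<comment> \<open>By induction on the number \<open>k\<close> of cells needed to reach \<open>t\<close>.\<close>
    have D: "\<bar>D t\<bar> \<le> real k * (2 * G * \<delta>) + \<eta> * (Z n t + F t)"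
      if "k \<le> m" "t \<in> {0..T * real k / real m}" for k t
      using that
    proof (induction k arbitrary: t)
      case 0
      then have "t = 0" by simp
      show ?case using \<open>t = 0\<close> by (simp add: D_def Z_def F_def set_lborel_integral_singleton)
    next
      case (Suc k)
      let ?q = "T * real k / real m" and ?q' = "T * real (Suc k) / real m"
      have q: "?q \<in> {0..T}" "?q' \<in> {0..T}"
        using Suc.prems(1) m(1) by (intro grid_points_le T; simp)+
      have IH: "\<bar>D t\<bar> \<le> real k * (2 * G * \<delta>) + \<eta> * (Z n t + F t)" if "t \<in> {0..?q}" for t
        using Suc that by auto
      have pos: "0 \<le> 2 * G * \<delta>" using G \<delta> by simp
      show ?case
      proof (cases "t \<le> ?q")
        case True
        then show ?thesis using IH[of t] Suc.prems pos by (simp add: distrib_right)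
      next
        case False
        then have t: "?q \<le> t" "t \<le> ?q'" "t \<le> T" "0 \<le> ?q" using Suc.prems q by auto
        have sub: "{?q..t} \<subseteq> {0..T}" using t by auto
        have c: "\<bar>g s - g ?q\<bar> \<le> \<eta>" if "s \<in> {?q..t}" for s
          using m(2)[of k s ?q] that Suc.prems t by (auto simp del: of_nat_Suc intro: less_imp_le)
        have 1: "\<bar>(LBINT s:{?q..t}. g s * H n s) - g ?q * (LBINT s:{?q..t}. H n s)\<bar> \<le> \<eta> * (LBINT s:{?q..t}. H n s)"
          by (rule set_integral_freeze_factor)
             (use c sub H in \<open>auto intro: continuous_on_subset[OF g] set_integrable_subset[OF H(1)]\<close>)
        have 2: "\<bar>(LBINT s:{?q..t}. g s * h s) - g ?q * (LBINT s:{?q..t}. h s)\<bar> \<le> \<eta> * (LBINT s:{?q..t}. h s)"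
          by (rule set_integral_freeze_factor)
             (use c sub h in \<open>auto intro: continuous_on_subset[OF g] set_integrable_subset[OF h(1)]\<close>)
        have Zt: "Z n t = Z n ?q + (LBINT s:{?q..t}. H n s)" and Ft: "F t = F ?q + (LBINT s:{?q..t}. h s)"
          unfolding Z_def F_def using t by (auto intro!: split H h)
        have Dt: "D t = D ?q + ((LBINT s:{?q..t}. g s * H n s) - (LBINT s:{?q..t}. g s * h s))"
          unfolding D_def using split[OF gH, of ?q t n] split[OF gh, of ?q t] t by simp
        have diff: "\<bar>(LBINT s:{?q..t}. H n s) - (LBINT s:{?q..t}. h s)\<bar> \<le> 2 * \<delta>"
          using Z[of t] Z[of ?q] t q Zt Ft by auto
        have 3: "\<bar>g ?q * (LBINT s:{?q..t}. H n s) - g ?q * (LBINT s:{?q..t}. h s)\<bar> \<le> G * (2 * \<delta>)"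
          unfolding right_diff_distrib[symmetric] abs_mult using diff G q by (intro mult_mono) auto
        have "\<bar>D t\<bar> \<le> \<bar>D ?q\<bar> + \<eta> * (LBINT s:{?q..t}. H n s) + \<eta> * (LBINT s:{?q..t}. h s) + G * (2 * \<delta>)"
          using Dt 1 2 3 by linarith
        also have "\<dots> \<le> real k * (2 * G * \<delta>) + \<eta> * (Z n ?q + F ?q) + \<eta> * (LBINT s:{?q..t}. H n s)
            + \<eta> * (LBINT s:{?q..t}. h s) + G * (2 * \<delta>)"
          using IH[of ?q] q by auto
        also have "\<dots> = real (Suc k) * (2 * G * \<delta>) + \<eta> * (Z n t + F t)"
          unfolding Zt Ft by (simp add: algebra_simps)
        finally show ?thesis .
      qed
    qed
    show ?case
    proof
      fix t assume t: "t \<in> {0..T}"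
      have \<open>Z n t \<le> Z n T\<close> using monoZ t by (auto simp: mono_on_def)
      moreover have "F t \<le> F T"
        using split[OF h(1), where r = t and t = T] nonneg[OF h(2), where r = t and t = T] t by (simp add: F_def)
      moreover have "Z n T \<le> F T + 1" using Z[of T] T by (auto simp: \<delta>_def abs_le_iff)
      ultimately have "\<eta> * (Z n t + F t) \<le> \<eta> * (2 * F T + 1)" using \<eta> by (intro mult_left_mono) auto
      also have "\<dots> = e / 2" using FT by (simp add: \<eta>_def field_simps)
      finally have "\<bar>D t\<bar> \<le> real m * (2 * G * \<delta>) + e / 2" using D[of m t] t m(1) by simp
      also have "real m * (2 * G * \<delta>) \<le> real m * (2 * G * (e / (8 * G * real m)))"
        using G by (intro mult_left_mono) (auto simp: \<delta>_def)
      also have "\<dots> = e / 4" using G m(1) by (simp add: field_simps)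
      finally show "dist (LBINT s:{0..t}. g s * H n s) (LBINT s:{0..t}. g s * h s) < e"
        using e by (simp add: D_def dist_real_def)
    qed
  qed
qed

section \<open>Linearisation of increments along a continuous path\<close>

text \<open>
  The two-sided form of the mean value theorem, covering all orders of \<open>y\<close> and \<open>z\<close> at once, since the
  sign of a path increment is unknown.
\<close>

lemma mean_value_between:
  fixes f f' :: "real \<Rightarrow> real"
  assumes "\<And>x. (f has_real_derivative f' x) (at x)"
  shows "\<exists>\<xi>. min y z \<le> \<xi> \<and> \<xi> \<le> max y z \<and> f z - f y = f' \<xi> * (z - y)"
proof (cases y z rule: linorder_cases)
  case less
  then obtain \<xi> where "y < \<xi>" "\<xi> < z" "f z - f y = (z - y) * f' \<xi>" using MVT2[OF less, of f f'] assms by blast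
  then show ?thesis by (intro exI[of _ \<xi>]) (auto simp: mult.commute)
next
  case equal then show ?thesis by auto
next
  case greater
  then obtain \<xi> where "z < \<xi>" "\<xi> < y" "f y - f z = (y - z) * f' \<xi>" using MVT2[OF greater, of f f'] assms by blast
  then show ?thesis by (intro exI[of _ \<xi>]) (auto simp: algebra_simps)
qed

text \<open>
  The increment over \<open>[s + \<epsilon>, s + 2 \<epsilon>]\<close> is linearised at \<open>x s\<close> and not at \<open>x (s + \<epsilon>)\<close>, so that the
  factor \<open>f' (x s)\<close> no longer depends on \<open>\<epsilon>\<close>.  The intermediate point lies close to \<open>x s\<close> by uniform
  continuity of the path, and \<open>f'\<close> is uniformly continuous on the compact range of the path.
\<close>

lemma increments_uniformly_linear:
  fixes f f' x :: "real \<Rightarrow> real"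
  assumes f: "\<And>y. (f has_real_derivative f' y) (at y)" and f': "continuous_on UNIV f'"
    and x: "continuous_on {0..} x" and T: "0 \<le> T" and \<eta>: "0 < \<eta>"
  shows "\<exists>d>0. \<forall>\<epsilon>. 0 < \<epsilon> \<longrightarrow> \<epsilon> < d \<longrightarrow> (\<forall>s\<in>{0..T}.
    \<bar>f (x (s + 2 * \<epsilon>)) - f (x (s + \<epsilon>)) - f' (x s) * (x (s + 2 * \<epsilon>) - x (s + \<epsilon>))\<bar>
      \<le> \<eta> * \<bar>x (s + 2 * \<epsilon>) - x (s + \<epsilon>)\<bar>)"
proof -
  have x': "continuous_on {0..T + 2} x" by (rule continuous_on_subset[OF x]) auto
  then have "bounded (x ` {0..T + 2})" by (intro compact_imp_bounded compact_continuous_image) auto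
  then obtain R where "\<forall>y\<in>x ` {0..T + 2}. norm y \<le> R" using bounded_iff by metis
  then have R: "\<And>s. s \<in> {0..T + 2} \<Longrightarrow> \<bar>x s\<bar> \<le> R" by auto
  have "uniformly_continuous_on {-R..R} f'"
    by (intro compact_uniformly_continuous continuous_on_subset[OF f']) auto
  then obtain \<rho> where \<rho>: "\<rho> > 0" "\<And>y z. y \<in> {-R..R} \<Longrightarrow> z \<in> {-R..R} \<Longrightarrow> \<bar>y - z\<bar> < \<rho> \<Longrightarrow> \<bar>f' y - f' z\<bar> < \<eta>"
    using \<eta> unfolding uniformly_continuous_on_def dist_real_def by metis
  have "uniformly_continuous_on {0..T + 2} x" using x' by (intro compact_uniformly_continuous) auto
  then obtain d where d: "d > 0" "\<And>s r. s \<in> {0..T + 2} \<Longrightarrow> r \<in> {0..T + 2} \<Longrightarrow> \<bar>s - r\<bar> < d \<Longrightarrow> \<bar>x s - x r\<bar> < \<rho>"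
    using \<rho>(1) unfolding uniformly_continuous_on_def dist_real_def by metis
  show ?thesis
  proof (intro exI[of _ "min 1 (d / 2)"] conjI allI impI ballI)
    show "0 < min 1 (d / 2)" using d by simp
    fix \<epsilon> s assume \<epsilon>: "0 < \<epsilon>" "\<epsilon> < min 1 (d / 2)" and s: "s \<in> {0..T}"
    let ?y = "x (s + \<epsilon>)" and ?z = "x (s + 2 * \<epsilon>)"
    obtain \<xi> where \<xi>: "min ?y ?z \<le> \<xi>" "\<xi> \<le> max ?y ?z" "f ?z - f ?y = f' \<xi> * (?z - ?y)"
      using mean_value_between[of f f' ?y ?z] f by blast
    have "\<bar>?y - x s\<bar> < \<rho>" "\<bar>?z - x s\<bar> < \<rho>" using \<epsilon> s by (intro d(2); auto)+
    then have near: "\<bar>\<xi> - x s\<bar> < \<rho>" using \<xi>(1,2) by linarith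
    have "\<bar>?y\<bar> \<le> R" "\<bar>?z\<bar> \<le> R" "\<bar>x s\<bar> \<le> R" using \<epsilon> s by (intro R; auto)+
    then have "\<xi> \<in> {-R..R}" "x s \<in> {-R..R}" using \<xi>(1,2) by auto
    then have "\<bar>f' \<xi> - f' (x s)\<bar> \<le> \<eta>" using \<rho>(2) near less_imp_le by blast
    moreover have "f ?z - f ?y - f' (x s) * (?z - ?y) = (f' \<xi> - f' (x s)) * (?z - ?y)"
      using \<xi>(3) by (simp add: algebra_simps)
    ultimately show "\<bar>f ?z - f ?y - f' (x s) * (?z - ?y)\<bar> \<le> \<eta> * \<bar>?z - ?y\<bar>"
      by (simp add: abs_mult mult_right_mono)
  qed
qed

section \<open>Moments of Gaussian variables\<close>

lemma gaussian_rv_integrable: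
  assumes "prob_space M" "gaussian_rv M X"
  shows "integrable M X"
proof -
  interpret prob_space M by fact
  have X: "X \<in> borel_measurable M" using assms by (auto simp: gaussian_rv_def)
  from assms(2) consider (d) \<mu> \<sigma> where "\<sigma> > 0" "distributed M lborel X (normal_density \<mu> \<sigma>)"
    | (c) \<mu> where "AE \<omega> in M. X \<omega> = \<mu>" by (auto simp: gaussian_rv_def)
  then show ?thesis
  proof cases
    case d
    show ?thesis
      using distributed_integrable[OF d(2), of "\<lambda>x. x"] integrable_normal_moment_nz_1[OF d(1), of \<mu>] d(1)
      by (simp add: normal_density_nonneg)
  next
    case c
    have "integrable M X \<longleftrightarrow> integrable M (\<lambda>_. \<mu>)" using c X by (intro integrable_cong_AE) auto
    then show ?thesis by simp
  qed
qed

lemma gaussian_rv_centered_cases: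
  assumes "prob_space M" "gaussian_rv M X" "prob_space.expectation M X = 0"
  obtains (normal) \<sigma> where "\<sigma> > 0" "distributed M lborel X (normal_density 0 \<sigma>)"
    | (zero) "AE \<omega> in M. X \<omega> = 0"
proof -
  interpret prob_space M by fact
  have X: "X \<in> borel_measurable M" using assms by (auto simp: gaussian_rv_def)
  from assms(2) consider (d) \<mu> \<sigma> where "\<sigma> > 0" "distributed M lborel X (normal_density \<mu> \<sigma>)"
    | (c) \<mu> where "AE \<omega> in M. X \<omega> = \<mu>" by (auto simp: gaussian_rv_def)
  then show ?thesis
  proof cases
    case d
    have "expectation X = \<mu>"
      using distributed_integral[OF d(2), of "\<lambda>x. x"] integral_normal_moment_nz_1[OF d(1), of \<mu>] d(1)
      by (simp add: normal_density_nonneg)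
    with assms(3) d normal show ?thesis by auto
  next
    case c
    have "expectation X = expectation (\<lambda>_. \<mu>)" using c X by (intro integral_cong_AE) auto
    with assms(3) c zero show ?thesis by (simp add: prob_space)
  qed
qed

lemma gaussian_rv_centered_moments:
  assumes M: "prob_space M" and X: "gaussian_rv M X" and E0: "prob_space.expectation M X = 0"
  shows gaussian_rv_power_integrable: "integrable M (\<lambda>\<omega>. X \<omega> ^ k)"
    and gaussian_rv_fourth_moment:
      "prob_space.expectation M (\<lambda>\<omega>. X \<omega> ^ 4) = 3 * (prob_space.expectation M (\<lambda>\<omega>. X \<omega> ^ 2))\<^sup>2"
proof -
  interpret prob_space M by fact
  have [measurable]: "X \<in> borel_measurable M" using X by (auto simp: gaussian_rv_def)
  have "integrable M (\<lambda>\<omega>. X \<omega> ^ k) \<and> expectation (\<lambda>\<omega>. X \<omega> ^ 4) = 3 * (expectation (\<lambda>\<omega>. X \<omega> ^ 2))\<^sup>2"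
    using M X E0
  proof (cases rule: gaussian_rv_centered_cases)
    case (normal \<sigma>)
    have 1: "integrable M (\<lambda>\<omega>. X \<omega> ^ k)"
      using distributed_integrable[OF normal(2), of "\<lambda>x. x ^ k"]
        integrable_normal_moment[OF normal(1), of 0 k] normal(1)
      by (simp add: normal_density_nonneg)
    have m: "expectation (\<lambda>\<omega>. X \<omega> ^ (2 * j)) = fact (2 * j) / ((2 / \<sigma>\<^sup>2)^j * fact j)" for j
      using distributed_integral[OF normal(2), of "\<lambda>x. x ^ (2 * j)"]
        integral_normal_moment_even[OF normal(1), of 0 j] normal(1)
      by (simp add: normal_density_nonneg)
    from m[of 1] m[of 2] normal(1) show ?thesis
      using 1 by (simp add: fact_numeral field_simps power2_eq_square)
  next
    case zero
    have "integrable M (\<lambda>\<omega>. X \<omega> ^ k) \<longleftrightarrow> integrable M (\<lambda>_. (0::real) ^ k)"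
      using zero by (intro integrable_cong_AE) auto
    moreover have "expectation (\<lambda>\<omega>. X \<omega> ^ j) = expectation (\<lambda>_. 0 ^ j)" for j
      using zero by (intro integral_cong_AE) auto
    ultimately show ?thesis by simp
  qed
  then show "integrable M (\<lambda>\<omega>. X \<omega> ^ k)"
    and "expectation (\<lambda>\<omega>. X \<omega> ^ 4) = 3 * (expectation (\<lambda>\<omega>. X \<omega> ^ 2))\<^sup>2" by auto
qed

text \<open>
  Isserlis' formula follows from the fourth moment \<open>3 \<sigma>\<^sup>4\<close> of a single Gaussian variable by
  polarisation: \<open>12 X\<^sup>2 Y\<^sup>2 = (X + Y)\<^sup>4 + (X - Y)\<^sup>4 - 2 X\<^sup>4 - 2 Y\<^sup>4\<close>.  The joint law enters only through
  \<open>X + Y\<close> and \<open>X - Y\<close>.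
\<close>

lemma gaussian_pair_moments:
  assumes M: "prob_space M"
    and G: "gaussian_rv M X" "gaussian_rv M Y" "gaussian_rv M (\<lambda>\<omega>. X \<omega> + Y \<omega>)" "gaussian_rv M (\<lambda>\<omega>. X \<omega> - Y \<omega>)"
    and E: "prob_space.expectation M X = 0" "prob_space.expectation M Y = 0"
  shows gaussian_pair_integrable: "integrable M (\<lambda>\<omega>. X \<omega> * Y \<omega>)"
    and gaussian_pair_squares_integrable: "integrable M (\<lambda>\<omega>. (X \<omega>)\<^sup>2 * (Y \<omega>)\<^sup>2)"
    and gaussian_pair_squares: "prob_space.expectation M (\<lambda>\<omega>. (X \<omega>)\<^sup>2 * (Y \<omega>)\<^sup>2) =
       prob_space.expectation M (\<lambda>\<omega>. (X \<omega>)\<^sup>2) * prob_space.expectation M (\<lambda>\<omega>. (Y \<omega>)\<^sup>2) +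
       2 * (prob_space.expectation M (\<lambda>\<omega>. X \<omega> * Y \<omega>))\<^sup>2"
proof -
  interpret prob_space M by fact
  note int = gaussian_rv_integrable[OF M G(1)] gaussian_rv_integrable[OF M G(2)]
  have E': "expectation (\<lambda>\<omega>. X \<omega> + Y \<omega>) = 0" "expectation (\<lambda>\<omega>. X \<omega> - Y \<omega>) = 0"
    using int E by auto
  note pw = gaussian_rv_power_integrable[OF M G(1) E(1)] gaussian_rv_power_integrable[OF M G(2) E(2)]
    gaussian_rv_power_integrable[OF M G(3) E'(1)] gaussian_rv_power_integrable[OF M G(4) E'(2)]
  note fm = gaussian_rv_fourth_moment[OF M G(1) E(1)] gaussian_rv_fourth_moment[OF M G(2) E(2)]
    gaussian_rv_fourth_moment[OF M G(3) E'(1)] gaussian_rv_fourth_moment[OF M G(4) E'(2)]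
  have XY: "(\<lambda>\<omega>. X \<omega> * Y \<omega>) = (\<lambda>\<omega>. ((X \<omega> + Y \<omega>)^2 - (X \<omega>)^2 - (Y \<omega>)^2) / 2)"
    by (auto simp: power2_eq_square algebra_simps)
  show i1: "integrable M (\<lambda>\<omega>. X \<omega> * Y \<omega>)"
    unfolding XY using pw by auto
  have XXYY: "(\<lambda>\<omega>. (X \<omega>)\<^sup>2 * (Y \<omega>)\<^sup>2) =
      (\<lambda>\<omega>. ((X \<omega> + Y \<omega>)^4 + (X \<omega> - Y \<omega>)^4 - 2 * X \<omega> ^ 4 - 2 * Y \<omega> ^ 4) / 12)"
    by (auto simp: power2_eq_square power4_eq_xxxx algebra_simps)
  show i2: "integrable M (\<lambda>\<omega>. (X \<omega>)\<^sup>2 * (Y \<omega>)\<^sup>2)"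
    unfolding XXYY using pw by auto
  let ?x = "expectation (\<lambda>\<omega>. (X \<omega>)\<^sup>2)" and ?y = "expectation (\<lambda>\<omega>. (Y \<omega>)\<^sup>2)"
    and ?c = "expectation (\<lambda>\<omega>. X \<omega> * Y \<omega>)"
  have p: "expectation (\<lambda>\<omega>. (X \<omega> + Y \<omega>)^2) = ?x + ?y + 2 * ?c"
    using pw i1 by (simp add: power2_sum mult.assoc)
  have m: "expectation (\<lambda>\<omega>. (X \<omega> - Y \<omega>)^2) = ?x + ?y - 2 * ?c"
    using pw i1 by (simp add: power2_diff mult.assoc)
  have "expectation (\<lambda>\<omega>. (X \<omega>)\<^sup>2 * (Y \<omega>)\<^sup>2) =
      (3 * (?x + ?y + 2 * ?c)\<^sup>2 + 3 * (?x + ?y - 2 * ?c)\<^sup>2 - 2 * (3 * ?x\<^sup>2) - 2 * (3 * ?y\<^sup>2)) / 12"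
    unfolding XXYY using pw by (simp add: fm p m)
  also have "\<dots> = ?x * ?y + 2 * ?c\<^sup>2" by (simp add: power2_eq_square algebra_simps)
  finally show "expectation (\<lambda>\<omega>. (X \<omega>)\<^sup>2 * (Y \<omega>)\<^sup>2) = ?x * ?y + 2 * ?c\<^sup>2" .
qed

text \<open>
  The defining property concerns coefficients indexed by a set of times; the coefficients of coinciding
  times have to be added up.
\<close>

lemma gaussian_process_combination:
  assumes "gaussian_process M B" "p \<ge> 0" "q \<ge> 0" "r \<ge> 0" "s \<ge> 0"
  shows "gaussian_rv M (\<lambda>\<omega>. \<alpha> * B p \<omega> + \<beta> * B q \<omega> + \<gamma> * B r \<omega> + \<delta> * B s \<omega>)"
proof -
  define c where "c t = (if t = p then \<alpha> else 0) + (if t = q then \<beta> else 0)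
    + (if t = r then \<gamma> else 0) + (if t = s then \<delta> else 0)" for t :: real
  have "gaussian_rv M (\<lambda>\<omega>. \<Sum>t\<in>{p, q, r, s}. c t * B t \<omega>)"
    using assms unfolding gaussian_process_def by auto
  moreover have "(\<Sum>t\<in>{p, q, r, s}. c t * B t \<omega>)
      = \<alpha> * B p \<omega> + \<beta> * B q \<omega> + \<gamma> * B r \<omega> + \<delta> * B s \<omega>" for \<omega>
  proof -
    have "(\<Sum>t\<in>{p, q, r, s}. (if t = z then x else 0) * B t \<omega>) = x * B z \<omega>"
      if "z \<in> {p, q, r, s}" for z x
    proof -
      have "(\<Sum>t\<in>{p, q, r, s}. (if t = z then x else 0) * B t \<omega>)
          = (\<Sum>t\<in>{p, q, r, s}. if t = z then x * B z \<omega> else 0)" by (intro sum.cong) auto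
      also have "\<dots> = x * B z \<omega>" using that by (subst sum.delta) auto
      finally show ?thesis .
    qed
    then show ?thesis unfolding c_def distrib_right sum.distrib by simp
  qed
  ultimately show ?thesis by simp
qed

section \<open>Measurability of continuous processes\<close>

text \<open>
  The process is the pointwise limit of its values at the times \<open>\<lfloor>t (n + 1)\<rfloor> / (n + 1)\<close>, which range over
  a countable set.  The truncation \<open>max 0\<close> is there because negative times are unconstrained.
\<close>

lemma continuous_process_jointly_measurable:
  fixes X :: "real \<Rightarrow> 'a \<Rightarrow> real"
  assumes meas: "\<And>t. t \<ge> 0 \<Longrightarrow> X t \<in> borel_measurable M"
    and cont: "\<And>\<omega>. \<omega> \<in> space M \<Longrightarrow> continuous_on {0..} (\<lambda>t. X t \<omega>)"
  shows "(\<lambda>p. X (max 0 (fst p)) (snd p)) \<in> borel_measurable (borel \<Otimes>\<^sub>M M)"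
proof (rule borel_measurable_LIMSEQ_real[where u =
    "\<lambda>n p. X (max 0 (real_of_int \<lfloor>max 0 (fst p) * real (Suc n)\<rfloor> / real (Suc n))) (snd p)"])
  fix n :: nat
  show "(\<lambda>p. X (max 0 (real_of_int \<lfloor>max 0 (fst p) * real (Suc n)\<rfloor> / real (Suc n))) (snd p))
      \<in> borel_measurable (borel \<Otimes>\<^sub>M M)"
  proof (rule measurable_compose_countable[where
      f = "\<lambda>i p. X (max 0 (real_of_int i / real (Suc n))) (snd p)" and g = "\<lambda>p. \<lfloor>max 0 (fst p) * real (Suc n)\<rfloor>"])
    fix i :: int
    have [measurable]: "X (max 0 (real_of_int i / real (Suc n))) \<in> borel_measurable M"
      by (rule meas) simp
    show "(\<lambda>p. X (max 0 (real_of_int i / real (Suc n))) (snd p)) \<in> borel_measurable (borel \<Otimes>\<^sub>M M)"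
      by measurable
  qed measurable
next
  fix p :: "real \<times> 'a" assume "p \<in> space (borel \<Otimes>\<^sub>M M)"
  then have \<omega>: "snd p \<in> space M" by (auto simp: space_pair_measure)
  define t where "t = max 0 (fst p)"
  have t: "t \<ge> 0" by (simp add: t_def)
  let ?q = "\<lambda>n. real_of_int \<lfloor>t * real (Suc n)\<rfloor> / real (Suc n)"
  have bounds: "t - 1 / real (Suc n) \<le> ?q n" "?q n \<le> t" for n
  proof -
    have "(t * real (Suc n) - 1) / real (Suc n) \<le> ?q n" "?q n \<le> t * real (Suc n) / real (Suc n)"
      by (intro divide_right_mono; linarith)+
    then show "t - 1 / real (Suc n) \<le> ?q n" "?q n \<le> t"
      by (simp_all add: diff_divide_distrib del: of_nat_Suc)
  qed
  have "?q \<longlonglongrightarrow> t"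
  proof (rule tendsto_sandwich)
    show "\<forall>\<^sub>F n in sequentially. t - 1 / real (Suc n) \<le> ?q n" "\<forall>\<^sub>F n in sequentially. ?q n \<le> t"
      by (rule always_eventually, rule allI, rule bounds)+
    show "(\<lambda>n. t - 1 / real (Suc n)) \<longlonglongrightarrow> t"
      using tendsto_diff[OF tendsto_const LIMSEQ_inverse_real_of_nat, of t] by (simp add: inverse_eq_divide)
  qed simp
  then have "(\<lambda>n. max 0 (?q n)) \<longlonglongrightarrow> max 0 t" by (intro tendsto_intros)
  then have "(\<lambda>n. max 0 (?q n)) \<longlonglongrightarrow> t" using t by simp
  then show "(\<lambda>n. X (max 0 (real_of_int \<lfloor>max 0 (fst p) * real (Suc n)\<rfloor> / real (Suc n))) (snd p))
      \<longlonglongrightarrow> X (max 0 (fst p)) (snd p)"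
    unfolding t_def[symmetric]
  proof (rule continuous_on_tendsto_compose[OF cont[OF \<omega>]])
    show "t \<in> {0..}" using t by simp
    show "\<forall>\<^sub>F n in sequentially. max 0 (?q n) \<in> {0..}"
      by (simp only: atLeast_iff max.cobounded1 eventually_True)
  qed
qed

text \<open>
  By continuity the uncountable union over \<open>t\<close> reduces to a countable dense set of times.
\<close>

lemma continuous_exceedance_measurable:
  fixes U :: "real \<Rightarrow> 'a \<Rightarrow> real"
  assumes meas: "\<And>t. t \<in> S \<Longrightarrow> U t \<in> borel_measurable M"
    and cont: "\<And>\<omega>. \<omega> \<in> space M \<Longrightarrow> continuous_on S (\<lambda>t. U t \<omega>)"
  shows "{\<omega> \<in> space M. \<exists>t\<in>S. \<bar>U t \<omega>\<bar> > \<delta>} \<in> sets M"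
proof -
  obtain D where D: "countable D" "D \<subseteq> S" "S \<subseteq> closure D" by (rule separable)
  have "\<exists>q\<in>D. \<bar>U q \<omega>\<bar> > \<delta>" if \<omega>: "\<omega> \<in> space M" and t: "t \<in> S" "\<bar>U t \<omega>\<bar> > \<delta>" for \<omega> t
  proof -
    have "continuous_on S (\<lambda>t. \<bar>U t \<omega>\<bar>)" by (intro continuous_on_rabs cont \<omega>)
    then have "\<exists>d>0. \<forall>x\<in>S. dist x t < d \<longrightarrow> dist \<bar>U x \<omega>\<bar> \<bar>U t \<omega>\<bar> < \<bar>U t \<omega>\<bar> - \<delta>"
      using t unfolding continuous_on_iff by (metis diff_gt_0_iff_gt)
    then obtain d where d: "d > 0" "\<And>x. x \<in> S \<Longrightarrow> dist x t < d \<Longrightarrow> dist \<bar>U x \<omega>\<bar> \<bar>U t \<omega>\<bar> < \<bar>U t \<omega>\<bar> - \<delta>"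
      by blast
    obtain q where q: "q \<in> D" "dist q t < d" using D(3) t(1) d(1) closure_approachable by blast
    then have "dist \<bar>U q \<omega>\<bar> \<bar>U t \<omega>\<bar> < \<bar>U t \<omega>\<bar> - \<delta>" using D(2) d(2) by blast
    then have "\<bar>U q \<omega>\<bar> > \<delta>" unfolding dist_real_def by linarith
    then show ?thesis using q by blast
  qed
  then have "{\<omega> \<in> space M. \<exists>t\<in>S. \<bar>U t \<omega>\<bar> > \<delta>} = (\<Union>q\<in>D. {\<omega> \<in> space M. \<bar>U q \<omega>\<bar> > \<delta>})"
    using D(2) by blast
  also have "\<dots> \<in> sets M"
  proof (rule sets.countable_UN'[OF D(1)])
    have "{\<omega> \<in> space M. \<bar>U q \<omega>\<bar> > \<delta>} \<in> sets M" if "q \<in> D" for q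
    proof -
      have [measurable]: "U q \<in> borel_measurable M" using meas that D(2) by blast
      show ?thesis by measurable
    qed
    then show "(\<lambda>q. {\<omega> \<in> space M. \<bar>U q \<omega>\<bar> > \<delta>}) ` D \<subseteq> sets M" by blast
  qed
  finally show ?thesis .
qed

section \<open>Convergence in probability and in the mean square\<close>

text \<open>
  A subsequence argument in one step.  If \<open>prob (E \<epsilon>)\<close> did not vanish, there would be \<open>\<epsilon>\<^sub>n \<longrightarrow> 0\<close> with
  \<open>prob (E \<epsilon>\<^sub>n) \<ge> \<eta>\<close> and with \<open>E (W \<epsilon>\<^sub>n i) < 2\<^sup>-\<^sup>n\<close> for all \<open>i \<le> n\<close>.  For each \<open>i\<close> these means are
  summable from the index \<open>i\<close> on, so almost surely \<open>W \<epsilon>\<^sub>n i \<longrightarrow> 0\<close> for all \<open>i\<close> simultaneously;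
  then almost every point leaves \<open>E \<epsilon>\<^sub>n\<close>, and dominated convergence contradicts the lower
  bound \<open>\<eta>\<close>.
\<close>

lemma (in prob_space) vanishing_probability_by_sequences:
  fixes W :: "real \<Rightarrow> nat \<Rightarrow> 'a \<Rightarrow> real" and E :: "real \<Rightarrow> 'a set"
  assumes W: "\<And>\<epsilon> i. \<epsilon> > 0 \<Longrightarrow> W \<epsilon> i \<in> borel_measurable M" "\<And>\<epsilon> i \<omega>. 0 \<le> W \<epsilon> i \<omega>"
    and conv: "\<And>i. ((\<lambda>\<epsilon>. \<integral>\<^sup>+\<omega>. W \<epsilon> i \<omega> \<partial>M) \<longlongrightarrow> 0) (at_right 0)"
    and E: "\<And>\<epsilon>. \<epsilon> > 0 \<Longrightarrow> E \<epsilon> \<in> events"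
    and path: "\<And>e \<omega>. (\<And>n. 0 < e n) \<Longrightarrow> e \<longlonglongrightarrow> 0 \<Longrightarrow> \<omega> \<in> space M \<Longrightarrow>
        (\<And>i. (\<lambda>n. W (e n) i \<omega>) \<longlonglongrightarrow> 0) \<Longrightarrow> \<forall>\<^sub>F n in sequentially. \<omega> \<notin> E (e n)"
  shows "((\<lambda>\<epsilon>. prob (E \<epsilon>)) \<longlongrightarrow> 0) (at_right 0)"
proof (rule ccontr)
  assume "\<not> ((\<lambda>\<epsilon>. prob (E \<epsilon>)) \<longlongrightarrow> 0) (at_right 0)"
  then obtain \<eta> where \<eta>: "\<eta> > 0" "\<not> (\<forall>\<^sub>F \<epsilon> in at_right 0. prob (E \<epsilon>) < \<eta>)"
    by (auto simp: tendsto_iff)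
  have "\<exists>\<epsilon>. 0 < \<epsilon> \<and> \<epsilon> < inverse (real (Suc n)) \<and> \<eta> \<le> prob (E \<epsilon>) \<and>
      (\<forall>i\<le>n. (\<integral>\<^sup>+\<omega>. W \<epsilon> i \<omega> \<partial>M) < ennreal ((1/2) ^ n))" for n
  proof (rule ccontr)
    assume none: "\<not> ?thesis"
    have 1: "\<forall>\<^sub>F \<epsilon> in at_right 0. \<forall>i\<in>{..n}. (\<integral>\<^sup>+\<omega>. W \<epsilon> i \<omega> \<partial>M) < ennreal ((1/2) ^ n)"
      by (intro eventually_ball_finite ballI order_tendstoD[OF conv]) auto
    have 2: "\<forall>\<^sub>F \<epsilon>::real in at_right 0. \<epsilon> \<in> {0<..<inverse (real (Suc n))}"
      by (rule eventually_at_right_real) simp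
    have "\<forall>\<^sub>F \<epsilon> in at_right 0. prob (E \<epsilon>) < \<eta>"
      using 1 2
    proof eventually_elim
      case (elim \<epsilon>)
      show ?case
      proof (rule ccontr)
        assume "\<not> prob (E \<epsilon>) < \<eta>"
        with elim none show False by (force simp: not_less)
      qed
    qed
    with \<eta>(2) show False by simp
  qed
  then obtain e where e: "\<And>n. 0 < e n" "\<And>n. e n < inverse (real (Suc n))" "\<And>n. \<eta> \<le> prob (E (e n))"
      "\<And>n i. i \<le> n \<Longrightarrow> (\<integral>\<^sup>+\<omega>. W (e n) i \<omega> \<partial>M) < ennreal ((1/2) ^ n)"
    by metis
  have e0: "e \<longlonglongrightarrow> 0"
    by (rule tendsto_sandwich[OF _ _ tendsto_const LIMSEQ_inverse_real_of_nat])
       (use e(1,2) in \<open>auto intro!: always_eventually less_imp_le\<close>)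
  note [measurable] = W(1)[OF e(1)] E[OF e(1)]
  have "AE \<omega> in M. (\<lambda>n. W (e n) i \<omega>) \<longlonglongrightarrow> 0" for i
  proof -
    \<comment> \<open>The bound on the \<open>i\<close>-th mean is available from index \<open>i\<close> on, hence the offset.\<close>
    have "(\<integral>\<^sup>+\<omega>. (\<Sum>n. ennreal (W (e (n + i)) i \<omega>)) \<partial>M) = (\<Sum>n. \<integral>\<^sup>+\<omega>. W (e (n + i)) i \<omega> \<partial>M)"
      by (rule nn_integral_suminf) measurable
    also have "\<dots> \<le> (\<Sum>n. ennreal ((1/2) ^ (n + i)))"
      by (intro suminf_le summableI less_imp_le[OF e(4)]) auto
    also have "\<dots> = ennreal (\<Sum>n. (1/2) ^ (n + i))"
      by (intro suminf_ennreal2 summable_ignore_initial_segment summable_geometric) auto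
    also have "\<dots> < \<infinity>" by simp
    finally have "AE \<omega> in M. (\<Sum>n. ennreal (W (e (n + i)) i \<omega>)) \<noteq> \<infinity>"
      by (intro nn_integral_noteq_infinite) auto
    then show ?thesis
    proof eventually_elim
      case (elim \<omega>)
      then have "summable (\<lambda>n. W (e (n + i)) i \<omega>)"
        using W(2) by (intro summable_suminf_not_top) auto
      then show ?case by (rule LIMSEQ_offset[where k = i, OF summable_LIMSEQ_zero])
    qed
  qed
  then have "AE \<omega> in M. \<forall>i. (\<lambda>n. W (e n) i \<omega>) \<longlonglongrightarrow> 0" by (simp add: AE_all_countable)
  then have "AE \<omega> in M. (\<lambda>n. indicator (E (e n)) \<omega> :: real) \<longlonglongrightarrow> 0"
  proof (rule AE_mp, intro AE_I2 impI)
    fix \<omega> assume "\<omega> \<in> space M" "\<forall>i. (\<lambda>n. W (e n) i \<omega>) \<longlonglongrightarrow> 0"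
    then have "\<forall>\<^sub>F n in sequentially. \<omega> \<notin> E (e n)" using e0 e(1) path by blast
    then show "(\<lambda>n. indicator (E (e n)) \<omega> :: real) \<longlonglongrightarrow> 0"
      by (intro tendsto_eventually) (auto elim!: eventually_mono)
  qed
  then have "(\<lambda>n. \<integral>\<omega>. indicator (E (e n)) \<omega> \<partial>M) \<longlonglongrightarrow> (\<integral>\<omega>. (0::real) \<partial>M)"
    by (intro integral_dominated_convergence[where w = "\<lambda>_. 1"]) (auto simp: indicator_def)
  then have "(\<lambda>n. prob (E (e n))) \<longlonglongrightarrow> 0" using E[OF e(1)] by simp
  then have "\<forall>\<^sub>F n in sequentially. prob (E (e n)) < \<eta>" using \<eta>(1) by (rule order_tendstoD)
  then obtain n where "prob (E (e n)) < \<eta>" by (auto simp: eventually_sequentially)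
  then show False using e(3)[of n] by simp
qed

text \<open>
  Expanding the square as \<open>(Z - F)\<^sup>2 + 2 F Z = Z\<^sup>2 + F\<^sup>2\<close> keeps all terms nonnegative, so that the
  computation takes place in \<open>[0, \<infinity>]\<close>, where \<open>Z\<^sub>n\<close> may have infinite mean for finitely many \<open>n\<close>.
\<close>

lemma (in prob_space) squared_deviation_tendsto_zero:
  fixes Z :: "nat \<Rightarrow> 'a \<Rightarrow> real"
  assumes [measurable]: "\<And>n. Z n \<in> borel_measurable M" and Z0: "\<And>n \<omega>. 0 \<le> Z n \<omega>" and F0: "0 \<le> F"
    and first: "(\<lambda>n. \<integral>\<^sup>+\<omega>. Z n \<omega> \<partial>M) \<longlonglongrightarrow> ennreal F"
    and second: "(\<lambda>n. \<integral>\<^sup>+\<omega>. ennreal (Z n \<omega>) * ennreal (Z n \<omega>) \<partial>M) \<longlonglongrightarrow> ennreal F * ennreal F"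
  shows "(\<lambda>n. \<integral>\<^sup>+\<omega>. ennreal ((Z n \<omega> - F)\<^sup>2) \<partial>M) \<longlonglongrightarrow> 0"
proof -
  let ?S = "\<lambda>n. \<integral>\<^sup>+\<omega>. ennreal (Z n \<omega>) * ennreal (Z n \<omega>) \<partial>M" and ?E = "\<lambda>n. \<integral>\<^sup>+\<omega>. Z n \<omega> \<partial>M"
  have expand: "(\<integral>\<^sup>+\<omega>. ennreal ((Z n \<omega> - F)\<^sup>2) \<partial>M) + ennreal (2 * F) * ?E n = ?S n + ennreal F * ennreal F" for n
  proof -
    have "(\<integral>\<^sup>+\<omega>. ennreal ((Z n \<omega> - F)\<^sup>2) \<partial>M) + ennreal (2 * F) * ?E n
        = (\<integral>\<^sup>+\<omega>. ennreal ((Z n \<omega> - F)\<^sup>2) + ennreal (2 * F) * ennreal (Z n \<omega>) \<partial>M)"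
      by (simp add: nn_integral_add nn_integral_cmult)
    also have "\<dots> = (\<integral>\<^sup>+\<omega>. ennreal (Z n \<omega>) * ennreal (Z n \<omega>) + ennreal F * ennreal F \<partial>M)"
    proof (rule nn_integral_cong)
      fix \<omega>
      have "(Z n \<omega> - F)\<^sup>2 + 2 * F * Z n \<omega> = Z n \<omega> * Z n \<omega> + F * F" by algebra
      then have "ennreal ((Z n \<omega> - F)\<^sup>2 + 2 * F * Z n \<omega>) = ennreal (Z n \<omega> * Z n \<omega> + F * F)" by simp
      then show "ennreal ((Z n \<omega> - F)\<^sup>2) + ennreal (2 * F) * ennreal (Z n \<omega>)
          = ennreal (Z n \<omega>) * ennreal (Z n \<omega>) + ennreal F * ennreal F"
        using Z0[of n \<omega>] F0 by (simp add: ennreal_mult)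
    qed
    also have "\<dots> = ?S n + ennreal F * ennreal F"
      by (simp add: nn_integral_add emeasure_space_1)
    finally show ?thesis .
  qed
  have lim: "(\<lambda>n. (?S n + ennreal F * ennreal F) - ennreal (2 * F) * ?E n)
      \<longlonglongrightarrow> (ennreal F * ennreal F + ennreal F * ennreal F) - ennreal (2 * F) * ennreal F"
    by (intro tendsto_diff_ennreal tendsto_add second tendsto_const ennreal_tendsto_cmult first)
       (auto simp: ennreal_mult_eq_top_iff)
  have "(ennreal F * ennreal F + ennreal F * ennreal F) - ennreal (2 * F) * ennreal F = 0"
    using F0 by (simp add: ennreal_mult[symmetric] ennreal_plus[symmetric] mult.assoc del: ennreal_plus)
  with lim have lim': "(\<lambda>n. (?S n + ennreal F * ennreal F) - ennreal (2 * F) * ?E n) \<longlonglongrightarrow> 0" by simp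
  have "\<forall>\<^sub>F n in sequentially. ?E n < \<top>"
    using order_tendstoD(2)[OF first, of \<top>] by simp
  then have "\<forall>\<^sub>F n in sequentially. (?S n + ennreal F * ennreal F) - ennreal (2 * F) * ?E n
      = (\<integral>\<^sup>+\<omega>. ennreal ((Z n \<omega> - F)\<^sup>2) \<partial>M)"
  proof eventually_elim
    case (elim n)
    then have "ennreal (2 * F) * ?E n \<noteq> \<top>" by (auto simp: ennreal_mult_eq_top_iff)
    then show ?case unfolding expand[symmetric] by (rule ennreal_add_diff_cancel_right)
  qed
  then show ?thesis using lim' by (rule Lim_transform_eventually[rotated])
qed

text \<open>
  A law of large numbers for random integrals \<open>\<integral> H\<^sub>n s ds\<close>: by Tonelli their first two moments are
  integrals of \<open>E H\<^sub>n s\<close> and of \<open>E H\<^sub>n s H\<^sub>n r\<close>.  If the latter factorises in the limit for almost all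
  pairs \<open>(s, r)\<close>, then the second moment tends to the square of the limit of the first.  Dominated
  convergence is applied in \<open>r\<close> for fixed \<open>s\<close> and then in \<open>s\<close>, so the exceptional set of the
  factorisation (in the application, the diagonal) need only be null section by section.
\<close>

lemma (in prob_space) random_integral_moments_tendsto:
  fixes H :: "nat \<Rightarrow> 's \<Rightarrow> 'a \<Rightarrow> ennreal" and N :: "'s measure"
  assumes N: "sigma_finite_measure N"
    and H [measurable]: "\<And>n. (\<lambda>p. H n (fst p) (snd p)) \<in> borel_measurable (N \<Otimes>\<^sub>M M)"
    and h [measurable]: "h \<in> borel_measurable N" and D [measurable]: "D \<in> borel_measurable N"
    and D_fin: "(\<integral>\<^sup>+s. D s \<partial>N) < \<infinity>"
    and mean: "AE s in N. (\<lambda>n. \<integral>\<^sup>+\<omega>. H n s \<omega> \<partial>M) \<longlonglongrightarrow> h s"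
    and mean_le: "AE s in N. \<forall>n. (\<integral>\<^sup>+\<omega>. H n s \<omega> \<partial>M) \<le> D s" and D_top: "AE s in N. D s < \<infinity>"
    and corr: "AE s in N. AE r in N. (\<lambda>n. \<integral>\<^sup>+\<omega>. H n s \<omega> * H n r \<omega> \<partial>M) \<longlonglongrightarrow> h s * h r"
    and corr_le: "AE s in N. AE r in N. \<forall>n. (\<integral>\<^sup>+\<omega>. H n s \<omega> * H n r \<omega> \<partial>M) \<le> ennreal C * (D s * D r)"
  shows "(\<lambda>n. \<integral>\<^sup>+\<omega>. (\<integral>\<^sup>+s. H n s \<omega> \<partial>N) \<partial>M) \<longlonglongrightarrow> (\<integral>\<^sup>+s. h s \<partial>N)"
    and "(\<lambda>n. \<integral>\<^sup>+\<omega>. (\<integral>\<^sup>+s. H n s \<omega> \<partial>N) * (\<integral>\<^sup>+s. H n s \<omega> \<partial>N) \<partial>M)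
      \<longlonglongrightarrow> (\<integral>\<^sup>+s. h s \<partial>N) * (\<integral>\<^sup>+s. h s \<partial>N)"
proof -
  interpret N: sigma_finite_measure N by fact
  interpret P: pair_sigma_finite N M ..
  have [measurable]: "(\<lambda>(s, \<omega>). H n s \<omega>) \<in> borel_measurable (N \<Otimes>\<^sub>M M)" for n
    using H[of n] by (simp add: split_beta')
  have "(\<integral>\<^sup>+\<omega>. (\<integral>\<^sup>+s. H n s \<omega> \<partial>N) \<partial>M) = (\<integral>\<^sup>+s. (\<integral>\<^sup>+\<omega>. H n s \<omega> \<partial>M) \<partial>N)" for n
    by (rule P.Fubini') measurable
  moreover have "(\<lambda>n. \<integral>\<^sup>+s. (\<integral>\<^sup>+\<omega>. H n s \<omega> \<partial>M) \<partial>N) \<longlonglongrightarrow> (\<integral>\<^sup>+s. h s \<partial>N)"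
  proof (rule nn_integral_dominated_convergence[where w = D])
    show "AE s in N. (\<integral>\<^sup>+\<omega>. H n s \<omega> \<partial>M) \<le> D s" for n
      using mean_le by eventually_elim simp
  qed (use mean D_fin in auto)
  ultimately show "(\<lambda>n. \<integral>\<^sup>+\<omega>. (\<integral>\<^sup>+s. H n s \<omega> \<partial>N) \<partial>M) \<longlonglongrightarrow> (\<integral>\<^sup>+s. h s \<partial>N)" by simp
  have tonelli: "(\<integral>\<^sup>+\<omega>. (\<integral>\<^sup>+s. H n s \<omega> \<partial>N) * (\<integral>\<^sup>+s. H n s \<omega> \<partial>N) \<partial>M) =
      (\<integral>\<^sup>+s. (\<integral>\<^sup>+r. (\<integral>\<^sup>+\<omega>. H n s \<omega> * H n r \<omega> \<partial>M) \<partial>N) \<partial>N)" for n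
  proof -
    have "(\<integral>\<^sup>+\<omega>. (\<integral>\<^sup>+s. H n s \<omega> \<partial>N) * (\<integral>\<^sup>+s. H n s \<omega> \<partial>N) \<partial>M) =
        (\<integral>\<^sup>+\<omega>. (\<integral>\<^sup>+s. H n s \<omega> * (\<integral>\<^sup>+r. H n r \<omega> \<partial>N) \<partial>N) \<partial>M)"
      by (intro nn_integral_cong nn_integral_multc[symmetric]) measurable
    also have "\<dots> = (\<integral>\<^sup>+s. (\<integral>\<^sup>+\<omega>. H n s \<omega> * (\<integral>\<^sup>+r. H n r \<omega> \<partial>N) \<partial>M) \<partial>N)"
      by (rule P.Fubini') measurable
    also have "\<dots> = (\<integral>\<^sup>+s. (\<integral>\<^sup>+\<omega>. (\<integral>\<^sup>+r. H n s \<omega> * H n r \<omega> \<partial>N) \<partial>M) \<partial>N)"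
      by (intro nn_integral_cong nn_integral_cmult[symmetric]) measurable
    also have "\<dots> = (\<integral>\<^sup>+s. (\<integral>\<^sup>+r. (\<integral>\<^sup>+\<omega>. H n s \<omega> * H n r \<omega> \<partial>M) \<partial>N) \<partial>N)"
      by (intro nn_integral_cong P.Fubini') measurable
    finally show ?thesis .
  qed
  have inner: "AE s in N. (\<lambda>n. \<integral>\<^sup>+r. (\<integral>\<^sup>+\<omega>. H n s \<omega> * H n r \<omega> \<partial>M) \<partial>N) \<longlonglongrightarrow> h s * (\<integral>\<^sup>+r. h r \<partial>N)"
    using corr corr_le D_top AE_space
  proof eventually_elim
    case (elim s)
    note [measurable] = elim(4)
    have "(\<lambda>n. \<integral>\<^sup>+r. (\<integral>\<^sup>+\<omega>. H n s \<omega> * H n r \<omega> \<partial>M) \<partial>N) \<longlonglongrightarrow> (\<integral>\<^sup>+r. h s * h r \<partial>N)"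
    proof (rule nn_integral_dominated_convergence[where w = "\<lambda>r. ennreal C * (D s * D r)"])
      show "(\<integral>\<^sup>+r. ennreal C * (D s * D r) \<partial>N) < \<infinity>"
        using D_fin elim(3) by (simp add: nn_integral_cmult ennreal_mult_less_top)
      show "AE r in N. (\<integral>\<^sup>+\<omega>. H n s \<omega> * H n r \<omega> \<partial>M) \<le> ennreal C * (D s * D r)" for n
        using elim(2) by eventually_elim simp
    qed (use elim in auto)
    then show ?case by (simp add: nn_integral_cmult)
  qed
  have inner_le: "AE s in N. (\<integral>\<^sup>+r. (\<integral>\<^sup>+\<omega>. H n s \<omega> * H n r \<omega> \<partial>M) \<partial>N)
      \<le> ennreal C * (\<integral>\<^sup>+r. D r \<partial>N) * D s" for n
    using corr_le
  proof eventually_elim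
    case (elim s)
    then have "(\<integral>\<^sup>+r. (\<integral>\<^sup>+\<omega>. H n s \<omega> * H n r \<omega> \<partial>M) \<partial>N) \<le> (\<integral>\<^sup>+r. ennreal C * (D s * D r) \<partial>N)"
      by (intro nn_integral_mono_AE) (auto elim!: eventually_mono)
    also have "\<dots> = ennreal C * (D s * (\<integral>\<^sup>+r. D r \<partial>N))" by (simp add: nn_integral_cmult)
    finally show ?case by (simp add: mult_ac)
  qed
  have "(\<lambda>n. \<integral>\<^sup>+s. (\<integral>\<^sup>+r. (\<integral>\<^sup>+\<omega>. H n s \<omega> * H n r \<omega> \<partial>M) \<partial>N) \<partial>N) \<longlonglongrightarrow> (\<integral>\<^sup>+s. h s * (\<integral>\<^sup>+r. h r \<partial>N) \<partial>N)"
  proof (rule nn_integral_dominated_convergence[where w = "\<lambda>s. ennreal C * (\<integral>\<^sup>+r. D r \<partial>N) * D s"])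
    show "(\<integral>\<^sup>+s. ennreal C * (\<integral>\<^sup>+r. D r \<partial>N) * D s \<partial>N) < \<infinity>"
      using D_fin by (simp add: nn_integral_cmult ennreal_mult_less_top)
  qed (use inner inner_le in auto)
  then show "(\<lambda>n. \<integral>\<^sup>+\<omega>. (\<integral>\<^sup>+s. H n s \<omega> \<partial>N) * (\<integral>\<^sup>+s. H n s \<omega> \<partial>N) \<partial>M)
      \<longlonglongrightarrow> (\<integral>\<^sup>+s. h s \<partial>N) * (\<integral>\<^sup>+s. h s \<partial>N)"
    by (simp add: tonelli nn_integral_multc)
qed

text \<open>
  Cauchy-Schwarz, by minimising \<open>E (X + k Y)\<^sup>2 \<ge> 0\<close> over \<open>k\<close>.
\<close>

lemma (in prob_space) expectation_product_squared_le:
  fixes X Y :: "'a \<Rightarrow> real"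
  assumes "integrable M (\<lambda>\<omega>. (X \<omega>)\<^sup>2)" "integrable M (\<lambda>\<omega>. (Y \<omega>)\<^sup>2)" "integrable M (\<lambda>\<omega>. X \<omega> * Y \<omega>)"
  shows "(expectation (\<lambda>\<omega>. X \<omega> * Y \<omega>))\<^sup>2 \<le> expectation (\<lambda>\<omega>. (X \<omega>)\<^sup>2) * expectation (\<lambda>\<omega>. (Y \<omega>)\<^sup>2)"
proof -
  let ?x = "expectation (\<lambda>\<omega>. (X \<omega>)\<^sup>2)" and ?y = "expectation (\<lambda>\<omega>. (Y \<omega>)\<^sup>2)"
    and ?c = "expectation (\<lambda>\<omega>. X \<omega> * Y \<omega>)"
  have quad: "0 \<le> ?x + 2 * k * ?c + k\<^sup>2 * ?y" for k
  proof -
    have "0 \<le> expectation (\<lambda>\<omega>. (X \<omega> + k * Y \<omega>)\<^sup>2)" by (rule Bochner_Integration.integral_nonneg) simp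
    also have "\<dots> = expectation (\<lambda>\<omega>. (X \<omega>)\<^sup>2 + 2 * k * (X \<omega> * Y \<omega>) + k\<^sup>2 * (Y \<omega>)\<^sup>2)"
      by (intro Bochner_Integration.integral_cong) (auto simp: power2_eq_square algebra_simps)
    also have "\<dots> = ?x + 2 * k * ?c + k\<^sup>2 * ?y" using assms by simp
    finally show ?thesis .
  qed
  have y0: "0 \<le> ?y" by (rule Bochner_Integration.integral_nonneg) simp
  show ?thesis
  proof (cases "?y = 0")
    case True
    \<comment> \<open>A nonnegative affine function of \<open>k\<close> is constant; the chosen \<open>k\<close> gives it the value \<open>-1\<close>.\<close>
    have "?c = 0"
    proof (rule ccontr)
      assume "?c \<noteq> 0"
      then show False using quad[of "- (?x + 1) / (2 * ?c)"] True by (simp add: field_simps)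
    qed
    then show ?thesis using True by simp
  next
    case False
    then have y: "?y > 0" using y0 by linarith
    have "0 \<le> (?x + 2 * (- ?c / ?y) * ?c + (- ?c / ?y)\<^sup>2 * ?y) * ?y"
      using quad[of "- ?c / ?y"] y by (intro mult_nonneg_nonneg) auto
    also have "\<dots> = ?x * ?y - ?c\<^sup>2" using y by (simp add: power2_eq_square field_simps)
    finally show ?thesis by simp
  qed
qed

section \<open>Increments of the weighted fractional Brownian motion\<close>

locale wfbm = prob_space M for M :: "'a measure" +
  fixes a b :: real and B :: "real \<Rightarrow> 'a \<Rightarrow> real"
  assumes a_gt: "a > -1" and b_bound: "\<bar>b\<bar> < 1" and ab: "\<bar>b\<bar> < 1 + a"
    and fbm: "weighted_fbm M a b B"
begin

lemma b_gt: "b > -1" and ab_gt: "a + b > -1"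
  using b_bound ab by auto

lemma Beta_pos: "Beta (a + 1) (b + 1) > 0"
  using a_gt b_gt by (intro Beta_real_pos) auto

lemma kappa_pos: "kappa a b > 0"
  using Beta_pos b_gt by (simp add: kappa_def)

lemma gaussian: "gaussian_process M B"
  using fbm by (simp add: weighted_fbm_def)

lemma gaussian_combination:
  assumes "p \<ge> 0" "q \<ge> 0" "r \<ge> 0" "s \<ge> 0"
  shows "gaussian_rv M (\<lambda>\<omega>. \<alpha> * B p \<omega> + \<beta> * B q \<omega> + \<gamma> * B r \<omega> + \<delta> * B s \<omega>)"
  by (rule gaussian_process_combination[OF gaussian assms])

lemma gaussian_rv_B: "t \<ge> 0 \<Longrightarrow> gaussian_rv M (B t)"
  using gaussian_combination[of t t t t 1 0 0 0] by simp

lemma B_measurable: "t \<ge> 0 \<Longrightarrow> B t \<in> borel_measurable M"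
  using gaussian_rv_B by (simp add: gaussian_rv_def)

lemma B_integrable: "t \<ge> 0 \<Longrightarrow> integrable M (B t)"
  using gaussian_rv_integrable[OF prob_space_axioms gaussian_rv_B] .

lemma B_centered: "t \<ge> 0 \<Longrightarrow> expectation (B t) = 0"
  using fbm by (auto simp: weighted_fbm_def)

lemma gaussian_increment:
  assumes "p \<ge> 0" "q \<ge> 0"
  shows "gaussian_rv M (\<lambda>\<omega>. B q \<omega> - B p \<omega>)" "expectation (\<lambda>\<omega>. B q \<omega> - B p \<omega>) = 0"
  using gaussian_combination[of q p p p 1 "-1" 0 0] assms B_integrable B_centered by auto

lemma B_product_integrable:
  assumes "p \<ge> 0" "q \<ge> 0"
  shows "integrable M (\<lambda>\<omega>. B p \<omega> * B q \<omega>)"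
  using gaussian_combination[of p q q q 1 1 0 0] gaussian_combination[of p q q q 1 "-1" 0 0] assms
  by (intro gaussian_pair_integrable[OF prob_space_axioms]) (auto simp: gaussian_rv_B B_centered)

lemma kernel_integrable:
  "0 \<le> s \<Longrightarrow> s \<le> t \<Longrightarrow> set_integrable lborel {0..s} (\<lambda>u. u powr a * (t - u) powr b)"
  by (rule set_integrable_subset[OF powr_kernel_set_integrable[of a b t]]) (use a_gt b_gt in auto)

lemma covariance:
  assumes "0 \<le> s" "s \<le> t"
  shows "expectation (\<lambda>\<omega>. B t \<omega> * B s \<omega>) = 1 / (2 * Beta (a + 1) (b + 1)) *
     ((LBINT u:{0..s}. u powr a * (t - u) powr b) + (LBINT u:{0..s}. u powr a * (s - u) powr b))"
proof -
  have "expectation (\<lambda>\<omega>. B t \<omega> * B s \<omega>) = 1 / (2 * Beta (a + 1) (b + 1)) *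
      (LBINT u:{0..min s t}. u powr a * ((t - u) powr b + (s - u) powr b))"
    using fbm assms by (auto simp: weighted_fbm_def)
  also have "min s t = s" using assms by simp
  also have "(LBINT u:{0..s}. u powr a * ((t - u) powr b + (s - u) powr b)) =
      (LBINT u:{0..s}. u powr a * (t - u) powr b) + (LBINT u:{0..s}. u powr a * (s - u) powr b)"
    unfolding distrib_left using assms by (intro set_integral_add kernel_integrable) auto
  finally show ?thesis .
qed

text \<open>
  Writing \<open>Q t s = \<integral>\<^sub>0\<^sup>s u\<^sup>a (t - u)\<^sup>b du\<close>, the covariance at \<open>s \<le> t\<close> is \<open>(Q t s + Q s s) / (2 Beta)\<close>.
  The terms \<open>Q s s\<close> cancel in the variance, which leaves \<open>(Q t t - Q t s) / Beta\<close>.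
\<close>

lemma increment_variance:
  assumes "0 \<le> s" "s \<le> t"
  shows "expectation (\<lambda>\<omega>. (B t \<omega> - B s \<omega>)\<^sup>2) =
    1 / Beta (a + 1) (b + 1) * (LBINT u:{s..t}. u powr a * (t - u) powr b)"
proof -
  have "expectation (\<lambda>\<omega>. (B t \<omega> - B s \<omega>)\<^sup>2) =
     expectation (\<lambda>\<omega>. B t \<omega> * B t \<omega> + B s \<omega> * B s \<omega> - 2 * (B t \<omega> * B s \<omega>))"
    by (simp add: power2_eq_square algebra_simps)
  also have "\<dots> = expectation (\<lambda>\<omega>. B t \<omega> * B t \<omega>) + expectation (\<lambda>\<omega>. B s \<omega> * B s \<omega>)
      - 2 * expectation (\<lambda>\<omega>. B t \<omega> * B s \<omega>)"
    using assms B_product_integrable by simp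
  also have "\<dots> = 1 / Beta (a + 1) (b + 1) * ((LBINT u:{0..t}. u powr a * (t - u) powr b) -
      (LBINT u:{0..s}. u powr a * (t - u) powr b))"
    unfolding covariance[OF assms] covariance[OF assms(1) order_refl]
      covariance[OF order_trans[OF assms] order_refl]
    using Beta_pos by (simp add: field_simps)
  also have "(LBINT u:{0..t}. u powr a * (t - u) powr b) =
      (LBINT u:{0..s}. u powr a * (t - u) powr b) + (LBINT u:{s..t}. u powr a * (t - u) powr b)"
    using assms by (intro set_lborel_integral_Icc_split kernel_integrable) auto
  finally show ?thesis by simp
qed

text \<open>
  For increments over non-overlapping intervals every term \<open>Q s s\<close> of the earlier times cancels, since
  it does not depend on the later time.
\<close>

lemma increment_covariance:
  assumes "0 \<le> s" "s \<le> s'" "s' \<le> r" "r \<le> r'"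
  shows "expectation (\<lambda>\<omega>. (B s' \<omega> - B s \<omega>) * (B r' \<omega> - B r \<omega>)) =
    1 / (2 * Beta (a + 1) (b + 1)) *
      (LBINT u:{s..s'}. u powr a * ((r' - u) powr b - (r - u) powr b))"
proof -
  have "expectation (\<lambda>\<omega>. (B s' \<omega> - B s \<omega>) * (B r' \<omega> - B r \<omega>)) =
     expectation (\<lambda>\<omega>. B r' \<omega> * B s' \<omega> - B r' \<omega> * B s \<omega> - B r \<omega> * B s' \<omega> + B r \<omega> * B s \<omega>)"
    by (simp add: algebra_simps)
  also have "\<dots> = expectation (\<lambda>\<omega>. B r' \<omega> * B s' \<omega>) - expectation (\<lambda>\<omega>. B r' \<omega> * B s \<omega>)
      - expectation (\<lambda>\<omega>. B r \<omega> * B s' \<omega>) + expectation (\<lambda>\<omega>. B r \<omega> * B s \<omega>)"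
    using assms B_product_integrable by simp
  also have "\<dots> = 1 / (2 * Beta (a + 1) (b + 1)) *
      (((LBINT u:{0..s'}. u powr a * (r' - u) powr b) - (LBINT u:{0..s}. u powr a * (r' - u) powr b)) -
       ((LBINT u:{0..s'}. u powr a * (r - u) powr b) - (LBINT u:{0..s}. u powr a * (r - u) powr b)))"
    using assms Beta_pos by (simp add: covariance field_simps)
  also have "(LBINT u:{0..s'}. u powr a * (r' - u) powr b) =
      (LBINT u:{0..s}. u powr a * (r' - u) powr b) + (LBINT u:{s..s'}. u powr a * (r' - u) powr b)"
    using assms by (intro set_lborel_integral_Icc_split kernel_integrable) auto
  also have "(LBINT u:{0..s'}. u powr a * (r - u) powr b) =
      (LBINT u:{0..s}. u powr a * (r - u) powr b) + (LBINT u:{s..s'}. u powr a * (r - u) powr b)"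
    using assms by (intro set_lborel_integral_Icc_split kernel_integrable) auto
  also have "(LBINT u:{0..s}. u powr a * (r' - u) powr b) + (LBINT u:{s..s'}. u powr a * (r' - u) powr b)
        - (LBINT u:{0..s}. u powr a * (r' - u) powr b) -
      ((LBINT u:{0..s}. u powr a * (r - u) powr b) + (LBINT u:{s..s'}. u powr a * (r - u) powr b)
        - (LBINT u:{0..s}. u powr a * (r - u) powr b)) =
      (LBINT u:{s..s'}. u powr a * (r' - u) powr b) - (LBINT u:{s..s'}. u powr a * (r - u) powr b)"
    by simp
  also have "\<dots> = (LBINT u:{s..s'}. u powr a * (r' - u) powr b - u powr a * (r - u) powr b)"
    using assms by (intro set_integral_diff(2)[symmetric] set_integrable_subset[OF kernel_integrable[of s']]) auto
  finally show ?thesis by (simp add: right_diff_distrib)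
qed

lemma increment_variance_bounds:
  assumes "0 < s" "0 < \<epsilon>"
  shows "kappa a b * min (s powr a) ((s + \<epsilon>) powr a) * \<epsilon> powr (1 + b) \<le> expectation (\<lambda>\<omega>. (B (s + \<epsilon>) \<omega> - B s \<omega>)\<^sup>2)"
    and "expectation (\<lambda>\<omega>. (B (s + \<epsilon>) \<omega> - B s \<omega>)\<^sup>2) \<le> kappa a b * max (s powr a) ((s + \<epsilon>) powr a) * \<epsilon> powr (1 + b)"
proof -
  let ?t = "s + \<epsilon>"
  have I: "set_integrable lborel {s..?t} (\<lambda>u. u powr a * (?t - u) powr b)"
    using assms by (intro set_integrable_subset[OF kernel_integrable[of ?t]]) auto
  have J: "set_integrable lborel {s..?t} (\<lambda>u. c * (?t - u) powr b)"
      "c * (\<epsilon> powr (1 + b) / (1 + b)) = (LBINT u:{s..?t}. c * (?t - u) powr b)" for c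
    using reflected_powr_set_integral[of b s ?t] b_gt assms by (auto simp: add.commute)
  have "min (s powr a) (?t powr a) * (\<epsilon> powr (1 + b) / (1 + b)) \<le> (LBINT u:{s..?t}. u powr a * (?t - u) powr b)"
    unfolding J using assms powr_between_endpoints[of s _ ?t a]
    by (intro set_integral_mono J I mult_right_mono) auto
  moreover have "(LBINT u:{s..?t}. u powr a * (?t - u) powr b) \<le> max (s powr a) (?t powr a) * (\<epsilon> powr (1 + b) / (1 + b))"
    unfolding J using assms powr_between_endpoints[of s _ ?t a]
    by (intro set_integral_mono J I mult_right_mono) auto
  ultimately have "1 / Beta (a + 1) (b + 1) * (min (s powr a) (?t powr a) * (\<epsilon> powr (1 + b) / (1 + b)))
      \<le> 1 / Beta (a + 1) (b + 1) * (LBINT u:{s..?t}. u powr a * (?t - u) powr b)"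
    "1 / Beta (a + 1) (b + 1) * (LBINT u:{s..?t}. u powr a * (?t - u) powr b)
      \<le> 1 / Beta (a + 1) (b + 1) * (max (s powr a) (?t powr a) * (\<epsilon> powr (1 + b) / (1 + b)))"
    using Beta_pos by (intro mult_left_mono; simp)+
  then show
    "kappa a b * min (s powr a) ((s + \<epsilon>) powr a) * \<epsilon> powr (1 + b) \<le> expectation (\<lambda>\<omega>. (B (s + \<epsilon>) \<omega> - B s \<omega>)\<^sup>2)"
    "expectation (\<lambda>\<omega>. (B (s + \<epsilon>) \<omega> - B s \<omega>)\<^sup>2) \<le> kappa a b * max (s powr a) ((s + \<epsilon>) powr a) * \<epsilon> powr (1 + b)"
    using assms by (simp_all add: increment_variance kappa_def mult_ac)
qed

text \<open>
  At a distance \<open>d\<close> from the singularity of the kernel the increment \<open>(r + \<epsilon> - u)\<^sup>b - (r - u)\<^sup>b\<close> is of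
  order \<open>\<epsilon>\<close>, and it is integrated over an interval of length \<open>\<epsilon>\<close>.
\<close>

lemma increment_covariance_bound:
  assumes "0 < s" "0 < \<epsilon>" "0 < d" "s + \<epsilon> + d \<le> r"
  shows "\<bar>expectation (\<lambda>\<omega>. (B (s + \<epsilon>) \<omega> - B s \<omega>) * (B (r + \<epsilon>) \<omega> - B r \<omega>))\<bar> \<le>
    1 / (2 * Beta (a + 1) (b + 1)) * (max (s powr a) ((s + \<epsilon>) powr a) * d powr (b - 1) * \<epsilon>\<^sup>2)"
proof -
  let ?C = "max (s powr a) ((s + \<epsilon>) powr a) * d powr (b - 1) * \<epsilon>"
  have I: "set_integrable lborel {s..s + \<epsilon>} (\<lambda>u. u powr a * ((r + \<epsilon> - u) powr b - (r - u) powr b))"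
    unfolding right_diff_distrib using assms
    by (intro set_integral_diff(1) set_integrable_subset[OF kernel_integrable[of "s + \<epsilon>"]]) auto
  have C: "set_integrable lborel {s..s + \<epsilon>} (\<lambda>u. ?C)"
    by (rule borel_integrable_atLeastAtMost') auto
  have "\<bar>u powr a * ((r + \<epsilon> - u) powr b - (r - u) powr b)\<bar> \<le> ?C" if "u \<in> {s..s + \<epsilon>}" for u
  proof -
    have "\<bar>(r - u + \<epsilon>) powr b - (r - u) powr b\<bar> \<le> \<epsilon> * d powr (b - 1)"
      using assms that b_bound by (intro powr_difference_bound) auto
    then have "\<bar>u powr a\<bar> * \<bar>(r - u + \<epsilon>) powr b - (r - u) powr b\<bar> \<le>
        max (s powr a) ((s + \<epsilon>) powr a) * (\<epsilon> * d powr (b - 1))"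
      using assms that powr_between_endpoints(2)[of s u "s + \<epsilon>" a] by (intro mult_mono) (auto simp: le_max_iff_disj)
    then show ?thesis by (simp add: abs_mult mult_ac diff_add_eq)
  qed
  then have "(LBINT u:{s..s + \<epsilon>}. \<bar>u powr a * ((r + \<epsilon> - u) powr b - (r - u) powr b)\<bar>) \<le> (LBINT u:{s..s + \<epsilon>}. ?C)"
    using set_integrable_abs[OF I] C by (intro set_integral_mono) auto
  also have "\<dots> = ?C * \<epsilon>"
    using assms by (simp add: set_lebesgue_integral_def)
  finally have "\<bar>LBINT u:{s..s + \<epsilon>}. u powr a * ((r + \<epsilon> - u) powr b - (r - u) powr b)\<bar> \<le> ?C * \<epsilon>"
    using integral_abs_bound[of lborel "\<lambda>u. indicator {s..s + \<epsilon>} u *\<^sub>R (u powr a * ((r + \<epsilon> - u) powr b - (r - u) powr b))"]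
    by (simp add: set_lebesgue_integral_def abs_mult)
  then show ?thesis
    using assms Beta_pos
    by (simp add: increment_covariance abs_mult divide_right_mono power2_eq_square mult.assoc)
qed

section \<open>Moments of the squared increments\<close>

text \<open>
  The integrand of \<open>J\<^sub>\<epsilon>(id, t)\<close> after the substitution \<open>s + \<epsilon>\<close> for \<open>s\<close>, which makes the domain of
  integration \<open>[0, t]\<close> independent of \<open>\<epsilon>\<close>.
\<close>

definition qv_density :: "real \<Rightarrow> real \<Rightarrow> 'a \<Rightarrow> real" where
  "qv_density \<epsilon> s \<omega> =
     (1 + a + b) / \<epsilon> powr (1 + b) * (B (s + 2 * \<epsilon>) \<omega> - B (s + \<epsilon>) \<omega>)\<^sup>2 * (s + \<epsilon>) powr b"

text \<open>
  The density of \<open>\<kappa> ds\<^sup>1\<^sup>+\<^sup>a\<^sup>+\<^sup>b\<close> with respect to Lebesgue measure.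
\<close>

definition limit_density :: "real \<Rightarrow> real" where
  "limit_density s = kappa a b * ((1 + a + b) * s powr (a + b))"

lemma qv_density_nonneg: "0 \<le> qv_density \<epsilon> s \<omega>"
  using ab_gt by (simp add: qv_density_def)

lemma limit_density_nonneg: "0 \<le> limit_density s"
  using ab_gt kappa_pos by (simp add: limit_density_def)

lemma qv_density_integrable: "0 < \<epsilon> \<Longrightarrow> 0 \<le> s \<Longrightarrow> integrable M (qv_density \<epsilon> s)"
  using gaussian_rv_power_integrable[OF prob_space_axioms gaussian_increment, of "s + \<epsilon>" "s + 2 * \<epsilon>" 2]
  by (auto simp: qv_density_def[abs_def])

lemma qv_density_mean_eq:
  "expectation (qv_density \<epsilon> s) =
     (1 + a + b) / \<epsilon> powr (1 + b) * expectation (\<lambda>\<omega>. (B (s + 2 * \<epsilon>) \<omega> - B (s + \<epsilon>) \<omega>)\<^sup>2) * (s + \<epsilon>) powr b"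
  by (simp add: qv_density_def[abs_def])

text \<open>
  The factor \<open>\<epsilon>\<^sup>1\<^sup>+\<^sup>b\<close> of the variance of an increment cancels the normalisation of \<open>J\<^sub>\<epsilon>\<close>.
\<close>

lemma qv_density_mean_bounds:
  assumes "0 < \<epsilon>" "0 \<le> s"
  shows "kappa a b * (1 + a + b) * min ((s + \<epsilon>) powr a) ((s + 2 * \<epsilon>) powr a) * (s + \<epsilon>) powr b
      \<le> expectation (qv_density \<epsilon> s)"
    and "expectation (qv_density \<epsilon> s)
      \<le> kappa a b * (1 + a + b) * max ((s + \<epsilon>) powr a) ((s + 2 * \<epsilon>) powr a) * (s + \<epsilon>) powr b"
proof -
  let ?V = "expectation (\<lambda>\<omega>. (B (s + 2 * \<epsilon>) \<omega> - B (s + \<epsilon>) \<omega>)\<^sup>2)"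
  have *: "kappa a b * c * \<epsilon> powr (1 + b) * ((1 + a + b) / \<epsilon> powr (1 + b)) * (s + \<epsilon>) powr b
      = kappa a b * (1 + a + b) * c * (s + \<epsilon>) powr b" for c
    using assms by simp
  have q: "0 \<le> (1 + a + b) / \<epsilon> powr (1 + b)" "0 \<le> (s + \<epsilon>) powr b" using ab_gt by auto
  have e: "s + \<epsilon> + \<epsilon> = s + 2 * \<epsilon>" by simp
  note V = increment_variance_bounds[of "s + \<epsilon>" \<epsilon>, unfolded e]
  have m: "expectation (qv_density \<epsilon> s) = ?V * ((1 + a + b) / \<epsilon> powr (1 + b)) * (s + \<epsilon>) powr b"
    by (simp add: qv_density_mean_eq)
  show "kappa a b * (1 + a + b) * min ((s + \<epsilon>) powr a) ((s + 2 * \<epsilon>) powr a) * (s + \<epsilon>) powr b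
      \<le> expectation (qv_density \<epsilon> s)"
    unfolding m *[symmetric] using assms by (intro mult_right_mono V q) auto
  show "expectation (qv_density \<epsilon> s)
      \<le> kappa a b * (1 + a + b) * max ((s + \<epsilon>) powr a) ((s + 2 * \<epsilon>) powr a) * (s + \<epsilon>) powr b"
    unfolding m *[symmetric] using assms by (intro mult_right_mono V q) auto
qed

lemma qv_density_mean_tendsto:
  assumes e: "\<And>n. 0 < e n" "e \<longlonglongrightarrow> 0" and s: "0 < s"
  shows "(\<lambda>n. expectation (qv_density (e n) s)) \<longlonglongrightarrow> limit_density s"
proof (rule tendsto_sandwich)
  have lim: "limit_density s = kappa a b * (1 + a + b) * s powr a * s powr b"
    using s by (simp add: limit_density_def powr_add mult_ac)
  have 1: "(\<lambda>n. (s + e n) powr p) \<longlonglongrightarrow> s powr p" for p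
    using tendsto_powr[OF tendsto_add[OF tendsto_const e(2)] tendsto_const, of s p] s by simp
  have 2: "(\<lambda>n. (s + 2 * e n) powr p) \<longlonglongrightarrow> s powr p" for p
    using tendsto_powr[OF tendsto_add[OF tendsto_const tendsto_mult[OF tendsto_const e(2)]] tendsto_const, of s 2 p] s
    by simp
  show "(\<lambda>n. kappa a b * (1 + a + b) * min ((s + e n) powr a) ((s + 2 * e n) powr a) * (s + e n) powr b)
      \<longlonglongrightarrow> limit_density s"
    unfolding lim using tendsto_min[OF 1[of a] 2[of a]] by (intro tendsto_mult tendsto_const 1) simp
  show "(\<lambda>n. kappa a b * (1 + a + b) * max ((s + e n) powr a) ((s + 2 * e n) powr a) * (s + e n) powr b)
      \<longlonglongrightarrow> limit_density s"
    unfolding lim using tendsto_max[OF 1[of a] 2[of a]] by (intro tendsto_mult tendsto_const 1) simp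
qed (use qv_density_mean_bounds e(1) s in \<open>auto intro!: always_eventually\<close>)

text \<open>
  The increment starts at \<open>s + \<epsilon>\<close> and ends no later than \<open>2 (s + \<epsilon>)\<close>, so \<open>u\<^sup>a\<close> varies on it by at most the
  factor \<open>max 1 (2\<^sup>a)\<close>.  This is why \<open>J\<^sub>\<epsilon>\<close> integrates from \<open>\<epsilon>\<close> and not from \<open>0\<close>.
\<close>

lemma qv_density_mean_le:
  assumes "0 < \<epsilon>" "0 \<le> s"
  shows "expectation (qv_density \<epsilon> s) \<le> kappa a b * (1 + a + b) * max 1 (2 powr a) * (s + \<epsilon>) powr (a + b)"
proof -
  have "max ((s + \<epsilon>) powr a) ((s + 2 * \<epsilon>) powr a) \<le> max 1 (2 powr a) * (s + \<epsilon>) powr a"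
  proof (cases "a \<ge> 0")
    case True
    have "(s + 2 * \<epsilon>) powr a \<le> (2 * (s + \<epsilon>)) powr a" using assms True by (intro powr_mono2) auto
    also have "\<dots> = 2 powr a * (s + \<epsilon>) powr a" using powr_mult[of 2 "s + \<epsilon>" a] assms by (simp only:)
    also have "\<dots> \<le> max 1 (2 powr a) * (s + \<epsilon>) powr a" by (intro mult_right_mono) auto
    moreover have "1 * (s + \<epsilon>) powr a \<le> max 1 (2 powr a) * (s + \<epsilon>) powr a" by (intro mult_right_mono) auto
    ultimately show ?thesis by simp
  next
    case False
    have "(s + 2 * \<epsilon>) powr a \<le> (s + \<epsilon>) powr a" using assms False by (intro powr_mono2') auto
    moreover have "1 * (s + \<epsilon>) powr a \<le> max 1 (2 powr a) * (s + \<epsilon>) powr a" by (intro mult_right_mono) auto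
    ultimately show ?thesis by simp
  qed
  then have "kappa a b * (1 + a + b) * max ((s + \<epsilon>) powr a) ((s + 2 * \<epsilon>) powr a) * (s + \<epsilon>) powr b
      \<le> kappa a b * (1 + a + b) * (max 1 (2 powr a) * (s + \<epsilon>) powr a) * (s + \<epsilon>) powr b"
    using kappa_pos ab_gt by (intro mult_right_mono mult_left_mono) auto
  also have "\<dots> = kappa a b * (1 + a + b) * max 1 (2 powr a) * (s + \<epsilon>) powr (a + b)"
    by (simp add: powr_add)
  finally show ?thesis using qv_density_mean_bounds(2)[OF assms] by linarith
qed

lemma increment_pair:
  assumes "0 < \<epsilon>" "0 \<le> s" "0 \<le> r"
  defines "X \<equiv> \<lambda>\<omega>. B (s + 2 * \<epsilon>) \<omega> - B (s + \<epsilon>) \<omega>" and "Y \<equiv> \<lambda>\<omega>. B (r + 2 * \<epsilon>) \<omega> - B (r + \<epsilon>) \<omega>"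
  shows increment_pair_integrable: "integrable M (\<lambda>\<omega>. X \<omega> * Y \<omega>)"
      "integrable M (\<lambda>\<omega>. (X \<omega>)\<^sup>2)" "integrable M (\<lambda>\<omega>. (X \<omega>)\<^sup>2 * (Y \<omega>)\<^sup>2)"
    and increment_pair_squares: "expectation (\<lambda>\<omega>. (X \<omega>)\<^sup>2 * (Y \<omega>)\<^sup>2) =
      expectation (\<lambda>\<omega>. (X \<omega>)\<^sup>2) * expectation (\<lambda>\<omega>. (Y \<omega>)\<^sup>2) + 2 * (expectation (\<lambda>\<omega>. X \<omega> * Y \<omega>))\<^sup>2"
proof -
  have X: "gaussian_rv M X" "expectation X = 0" and Y: "gaussian_rv M Y" "expectation Y = 0"
    unfolding X_def Y_def using gaussian_increment assms by auto
  have S: "gaussian_rv M (\<lambda>\<omega>. X \<omega> + Y \<omega>)" "gaussian_rv M (\<lambda>\<omega>. X \<omega> - Y \<omega>)"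
    using gaussian_combination[of "s + 2 * \<epsilon>" "s + \<epsilon>" "r + 2 * \<epsilon>" "r + \<epsilon>" 1 "-1" 1 "-1"]
      gaussian_combination[of "s + 2 * \<epsilon>" "s + \<epsilon>" "r + 2 * \<epsilon>" "r + \<epsilon>" 1 "-1" "-1" 1] assms(1-3)
    by (auto simp: X_def Y_def algebra_simps)
  show "integrable M (\<lambda>\<omega>. (X \<omega>)\<^sup>2)" by (rule gaussian_rv_power_integrable[OF prob_space_axioms X])
  note P = gaussian_pair_moments[OF prob_space_axioms X(1) Y(1) S X(2) Y(2)]
  show "integrable M (\<lambda>\<omega>. X \<omega> * Y \<omega>)" "integrable M (\<lambda>\<omega>. (X \<omega>)\<^sup>2 * (Y \<omega>)\<^sup>2)"
    "expectation (\<lambda>\<omega>. (X \<omega>)\<^sup>2 * (Y \<omega>)\<^sup>2) =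
      expectation (\<lambda>\<omega>. (X \<omega>)\<^sup>2) * expectation (\<lambda>\<omega>. (Y \<omega>)\<^sup>2) + 2 * (expectation (\<lambda>\<omega>. X \<omega> * Y \<omega>))\<^sup>2"
    by (fact P)+
qed

text \<open>
  Scaled so that its square, up to the factor \<open>2\<close> and the weights \<open>(s + \<epsilon>)\<^sup>b\<close> and \<open>(r + \<epsilon>)\<^sup>b\<close>, is the covariance term of
  Isserlis' formula for the product of the densities at \<open>s\<close> and \<open>r\<close>.
\<close>

definition normalized_covariance :: "real \<Rightarrow> real \<Rightarrow> real \<Rightarrow> real" where
  "normalized_covariance \<epsilon> s r = (1 + a + b) / \<epsilon> powr (1 + b) *
     expectation (\<lambda>\<omega>. (B (s + 2 * \<epsilon>) \<omega> - B (s + \<epsilon>) \<omega>) * (B (r + 2 * \<epsilon>) \<omega> - B (r + \<epsilon>) \<omega>))"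

text \<open>
  Isserlis' formula for the increments at \<open>s\<close> and \<open>r\<close>.  The constant \<open>3\<close> arises because, by
  Cauchy-Schwarz, the covariance term is at most twice the product of the means.
\<close>

lemma qv_density_correlation:
  assumes "0 < \<epsilon>" "0 \<le> s" "0 \<le> r"
  shows qv_density_product_integrable: "integrable M (\<lambda>\<omega>. qv_density \<epsilon> s \<omega> * qv_density \<epsilon> r \<omega>)"
    and qv_density_product_mean: "expectation (\<lambda>\<omega>. qv_density \<epsilon> s \<omega> * qv_density \<epsilon> r \<omega>) =
      expectation (qv_density \<epsilon> s) * expectation (qv_density \<epsilon> r)
      + 2 * (normalized_covariance \<epsilon> s r)\<^sup>2 * ((s + \<epsilon>) powr b * (r + \<epsilon>) powr b)"
    and qv_density_product_mean_le: "expectation (\<lambda>\<omega>. qv_density \<epsilon> s \<omega> * qv_density \<epsilon> r \<omega>) \<le>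
      3 * (expectation (qv_density \<epsilon> s) * expectation (qv_density \<epsilon> r))"
proof -
  let ?X = "\<lambda>\<omega>. B (s + 2 * \<epsilon>) \<omega> - B (s + \<epsilon>) \<omega>" and ?Y = "\<lambda>\<omega>. B (r + 2 * \<epsilon>) \<omega> - B (r + \<epsilon>) \<omega>"
  define q where "q = (1 + a + b) / \<epsilon> powr (1 + b)"
  define w where "w = (s + \<epsilon>) powr b * (r + \<epsilon>) powr b"
  note I = increment_pair_integrable[OF assms] increment_pair_integrable[OF assms(1,3,2)]
  have eq: "(\<lambda>\<omega>. qv_density \<epsilon> s \<omega> * qv_density \<epsilon> r \<omega>) = (\<lambda>\<omega>. (q\<^sup>2 * w) * ((?X \<omega>)\<^sup>2 * (?Y \<omega>)\<^sup>2))"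
    by (simp add: qv_density_def q_def w_def power2_eq_square mult_ac)
  show "integrable M (\<lambda>\<omega>. qv_density \<epsilon> s \<omega> * qv_density \<epsilon> r \<omega>)"
    unfolding eq by (rule integrable_mult_right) (rule I)
  have prod: "expectation (\<lambda>\<omega>. qv_density \<epsilon> s \<omega> * qv_density \<epsilon> r \<omega>) =
      (q\<^sup>2 * w) * (expectation (\<lambda>\<omega>. (?X \<omega>)\<^sup>2) * expectation (\<lambda>\<omega>. (?Y \<omega>)\<^sup>2)
        + 2 * (expectation (\<lambda>\<omega>. ?X \<omega> * ?Y \<omega>))\<^sup>2)"
    unfolding eq increment_pair_squares[OF assms, symmetric] by (rule integral_mult_right_zero)
  have means: "expectation (qv_density \<epsilon> s) * expectation (qv_density \<epsilon> r) =
      (q\<^sup>2 * w) * (expectation (\<lambda>\<omega>. (?X \<omega>)\<^sup>2) * expectation (\<lambda>\<omega>. (?Y \<omega>)\<^sup>2))"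
    by (simp add: qv_density_mean_eq q_def w_def power2_eq_square mult_ac)
  show "expectation (\<lambda>\<omega>. qv_density \<epsilon> s \<omega> * qv_density \<epsilon> r \<omega>) =
      expectation (qv_density \<epsilon> s) * expectation (qv_density \<epsilon> r)
      + 2 * (normalized_covariance \<epsilon> s r)\<^sup>2 * ((s + \<epsilon>) powr b * (r + \<epsilon>) powr b)"
    unfolding prod means normalized_covariance_def q_def[symmetric] w_def[symmetric]
    by (simp add: power2_eq_square algebra_simps)
  have "(expectation (\<lambda>\<omega>. ?X \<omega> * ?Y \<omega>))\<^sup>2 \<le> expectation (\<lambda>\<omega>. (?X \<omega>)\<^sup>2) * expectation (\<lambda>\<omega>. (?Y \<omega>)\<^sup>2)"
    by (rule expectation_product_squared_le) (use I in auto)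
  moreover have "0 \<le> q\<^sup>2 * w" by (simp add: w_def)
  ultimately have "(q\<^sup>2 * w) * (expectation (\<lambda>\<omega>. ?X \<omega> * ?Y \<omega>))\<^sup>2
      \<le> (q\<^sup>2 * w) * (expectation (\<lambda>\<omega>. (?X \<omega>)\<^sup>2) * expectation (\<lambda>\<omega>. (?Y \<omega>)\<^sup>2))" by (intro mult_left_mono)
  then show "expectation (\<lambda>\<omega>. qv_density \<epsilon> s \<omega> * qv_density \<epsilon> r \<omega>) \<le>
      3 * (expectation (qv_density \<epsilon> s) * expectation (qv_density \<epsilon> r))"
    unfolding prod means distrib_left by linarith
qed

text \<open>
  For \<open>s < r\<close> and small \<open>\<epsilon>\<close> the two increments are disjoint and at least \<open>(r - s) / 2\<close> apart, so
  their covariance is \<open>O(\<epsilon>\<^sup>2)\<close>; after normalisation \<open>\<epsilon>\<^sup>1\<^sup>-\<^sup>b\<close> remains, and \<open>b < 1\<close>.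
\<close>

lemma normalized_covariance_tendsto_zero:
  assumes e: "\<And>n. 0 < e n" "e \<longlonglongrightarrow> 0" and sr: "0 < s" "s < r"
  shows "(\<lambda>n. normalized_covariance (e n) s r) \<longlonglongrightarrow> 0"
proof -
  define d where "d = (r - s) / 2"
  have d: "d > 0" using sr by (simp add: d_def)
  define C where "C = (1 + a + b) * (1 / (2 * Beta (a + 1) (b + 1)))"
  let ?g = "\<lambda>n. C * (max ((s + e n) powr a) ((s + 2 * e n) powr a) * d powr (b - 1) * e n powr (1 - b))"
  have "\<forall>\<^sub>F n in sequentially. e n < d" by (rule order_tendstoD(2)[OF e(2) d])
  then have bound: "\<forall>\<^sub>F n in sequentially. norm (normalized_covariance (e n) s r) \<le> ?g n"
  proof eventually_elim
    case (elim n)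
    let ?\<epsilon> = "e n"
    have q: "0 \<le> (1 + a + b) / ?\<epsilon> powr (1 + b)" using ab_gt by simp
    have gap: "s + ?\<epsilon> + ?\<epsilon> + d \<le> r + ?\<epsilon>" using elim by (simp add: d_def field_simps)
    have eq: "p + ?\<epsilon> + ?\<epsilon> = p + 2 * ?\<epsilon>" for p by simp
    have "norm (normalized_covariance ?\<epsilon> s r) = (1 + a + b) / ?\<epsilon> powr (1 + b) *
        \<bar>expectation (\<lambda>\<omega>. (B (s + 2 * ?\<epsilon>) \<omega> - B (s + ?\<epsilon>) \<omega>) * (B (r + 2 * ?\<epsilon>) \<omega> - B (r + ?\<epsilon>) \<omega>))\<bar>"
      unfolding normalized_covariance_def real_norm_def abs_mult using q by (simp only: abs_of_nonneg)
    also have "\<dots> \<le> (1 + a + b) / ?\<epsilon> powr (1 + b) * (1 / (2 * Beta (a + 1) (b + 1)) *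
        (max ((s + ?\<epsilon>) powr a) ((s + 2 * ?\<epsilon>) powr a) * d powr (b - 1) * ?\<epsilon>\<^sup>2))"
      using increment_covariance_bound[of "s + ?\<epsilon>" ?\<epsilon> d "r + ?\<epsilon>", unfolded eq] gap[unfolded eq] sr e(1)[of n] d
      by (intro mult_left_mono q) simp
    also have "\<dots> = C * (max ((s + ?\<epsilon>) powr a) ((s + 2 * ?\<epsilon>) powr a) * d powr (b - 1) * (?\<epsilon>\<^sup>2 / ?\<epsilon> powr (1 + b)))"
      by (simp add: C_def mult_ac)
    also have "?\<epsilon>\<^sup>2 / ?\<epsilon> powr (1 + b) = ?\<epsilon> powr (1 - b)"
      using e(1)[of n] by (simp add: powr_numeral[symmetric] powr_diff[symmetric] del: powr_numeral)
    finally show ?case .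
  qed
  have 1: "(\<lambda>n. (s + e n) powr a) \<longlonglongrightarrow> s powr a"
    using tendsto_powr[OF tendsto_add[OF tendsto_const e(2)] tendsto_const, of s a] sr by simp
  have 2: "(\<lambda>n. (s + 2 * e n) powr a) \<longlonglongrightarrow> s powr a"
    using tendsto_powr[OF tendsto_add[OF tendsto_const tendsto_mult[OF tendsto_const e(2)]] tendsto_const, of s 2 a] sr
    by simp
  have 3: "(\<lambda>n. e n powr (1 - b)) \<longlonglongrightarrow> 0"
    by (rule tendsto_zero_powrI[OF e(2) tendsto_const])
       (use b_bound e(1) in \<open>auto intro!: always_eventually less_imp_le\<close>)
  have "?g \<longlonglongrightarrow> C * (max (s powr a) (s powr a) * d powr (b - 1) * 0)"
    by (intro tendsto_mult tendsto_const tendsto_max 1 2 3)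
  then have "?g \<longlonglongrightarrow> 0" by simp
  then show ?thesis using bound by (rule Lim_null_comparison[rotated])
qed

lemma normalized_covariance_commute: "normalized_covariance \<epsilon> s r = normalized_covariance \<epsilon> r s"
  by (simp add: normalized_covariance_def mult.commute)

lemma qv_density_product_mean_tendsto:
  assumes e: "\<And>n. 0 < e n" "e \<longlonglongrightarrow> 0" and sr: "0 < s" "0 < r" "s \<noteq> r"
  shows "(\<lambda>n. expectation (\<lambda>\<omega>. qv_density (e n) s \<omega> * qv_density (e n) r \<omega>)) \<longlonglongrightarrow> limit_density s * limit_density r"
proof -
  have c: "(\<lambda>n. normalized_covariance (e n) s r) \<longlonglongrightarrow> 0"
    using normalized_covariance_tendsto_zero[OF e, of s r] normalized_covariance_tendsto_zero[OF e, of r s] sr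
    by (cases "s < r") (auto simp: normalized_covariance_commute[of _ s r])
  have p: "(\<lambda>n. (x + e n) powr b) \<longlonglongrightarrow> x powr b" if "x > 0" for x
    using tendsto_powr[OF tendsto_add[OF tendsto_const e(2)] tendsto_const, of x b] that by simp
  have "(\<lambda>n. expectation (qv_density (e n) s) * expectation (qv_density (e n) r)
        + 2 * (normalized_covariance (e n) s r)\<^sup>2 * ((s + e n) powr b * (r + e n) powr b))
      \<longlonglongrightarrow> limit_density s * limit_density r + 2 * 0\<^sup>2 * (s powr b * r powr b)"
    using sr by (intro tendsto_add tendsto_mult tendsto_power tendsto_const qv_density_mean_tendsto e c p) auto
  then show ?thesis using sr e(1) by (simp add: qv_density_product_mean less_imp_le)
qed

section \<open>Mean square convergence of the integrated squared increments\<close>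

lemma B_continuous: "\<omega> \<in> space M \<Longrightarrow> continuous_on {0..} (\<lambda>t. B t \<omega>)"
  using fbm by (auto simp: weighted_fbm_def)

lemma B_shift_continuous:
  assumes "\<omega> \<in> space M" "0 \<le> c"
  shows "continuous_on {0..t} (\<lambda>s. B (s + c) \<omega>)"
  by (rule continuous_on_compose2[OF B_continuous[OF assms(1)]]) (use assms in \<open>auto intro!: continuous_intros\<close>)

lemma B_shift_measurable:
  "(\<lambda>(s, \<omega>). B (max 0 (s + c)) \<omega>) \<in> borel_measurable (lborel \<Otimes>\<^sub>M M)"
proof -
  have 1: "(\<lambda>p. (fst p + c, snd p)) \<in> lborel \<Otimes>\<^sub>M M \<rightarrow>\<^sub>M borel \<Otimes>\<^sub>M M" by measurable
  have 2: "(\<lambda>p. B (max 0 (fst p)) (snd p)) \<in> borel_measurable (borel \<Otimes>\<^sub>M M)"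
    by (rule continuous_process_jointly_measurable[OF B_measurable B_continuous])
  show ?thesis using measurable_compose[OF 1 2] by (simp add: split_beta')
qed

text \<open>
  Measurability of time integrals of functionals of two values of the process, as needed both for
  \<open>J\<^sub>\<epsilon>\<close> and for its limit.  On \<open>[0, t]\<close> the truncation of negative times is invisible.
\<close>

lemma B_functional_integral_measurable:
  fixes \<Psi> :: "real \<Rightarrow> real \<Rightarrow> real \<Rightarrow> real"
  assumes c: "0 \<le> c" "0 \<le> c'"
    and \<Psi> [measurable]: "(\<lambda>(s, y, z). \<Psi> s y z) \<in> borel_measurable (borel \<Otimes>\<^sub>M borel \<Otimes>\<^sub>M borel)"
  shows "(\<lambda>(s, \<omega>). indicator {0..t} s * \<Psi> s (B (s + c) \<omega>) (B (s + c') \<omega>)) \<in> borel_measurable (lborel \<Otimes>\<^sub>M M)"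
    and "(\<lambda>\<omega>. LBINT s:{0..t}. \<Psi> s (B (s + c) \<omega>) (B (s + c') \<omega>)) \<in> borel_measurable M"
proof -
  have "(\<lambda>p. (fst p, B (max 0 (fst p + c)) (snd p), B (max 0 (fst p + c')) (snd p)))
      \<in> lborel \<Otimes>\<^sub>M M \<rightarrow>\<^sub>M borel \<Otimes>\<^sub>M borel \<Otimes>\<^sub>M borel"
    by (intro measurable_Pair) (use B_shift_measurable in \<open>auto simp: split_beta'\<close>)
  from measurable_compose[OF this \<Psi>]
  have [measurable]: "(\<lambda>p. \<Psi> (fst p) (B (max 0 (fst p + c)) (snd p)) (B (max 0 (fst p + c')) (snd p)))
      \<in> borel_measurable (lborel \<Otimes>\<^sub>M M)" by simp
  have "(\<lambda>(s, \<omega>). indicator {0..t} s * \<Psi> s (B (max 0 (s + c)) \<omega>) (B (max 0 (s + c')) \<omega>)) \<in> borel_measurable (lborel \<Otimes>\<^sub>M M)"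
    unfolding split_beta' by measurable
  also have "(\<lambda>(s, \<omega>). indicator {0..t} s * \<Psi> s (B (max 0 (s + c)) \<omega>) (B (max 0 (s + c')) \<omega>)) =
      (\<lambda>(s, \<omega>). indicator {0..t} s * \<Psi> s (B (s + c) \<omega>) (B (s + c') \<omega>))"
    using c by (auto simp: fun_eq_iff indicator_def max_def)
  finally show 2 [measurable]: "(\<lambda>(s, \<omega>). indicator {0..t} s * \<Psi> s (B (s + c) \<omega>) (B (s + c') \<omega>)) \<in> borel_measurable (lborel \<Otimes>\<^sub>M M)" .
  show "(\<lambda>\<omega>. LBINT s:{0..t}. \<Psi> s (B (s + c) \<omega>) (B (s + c') \<omega>)) \<in> borel_measurable M"
    unfolding set_lebesgue_integral_def real_scaleR_def
    by (rule lborel.borel_measurable_lebesgue_integral) measurable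
qed

lemma qv_density_measurable:
  assumes "0 < \<epsilon>"
  shows "(\<lambda>(s, \<omega>). indicator {0..t} s * qv_density \<epsilon> s \<omega>) \<in> borel_measurable (lborel \<Otimes>\<^sub>M M)"
    and "(\<lambda>\<omega>. LBINT s:{0..t}. qv_density \<epsilon> s \<omega>) \<in> borel_measurable M"
  unfolding qv_density_def using assms
  by (intro B_functional_integral_measurable[where
        \<Psi> = "\<lambda>s y z. (1 + a + b) / \<epsilon> powr (1 + b) * (y - z)\<^sup>2 * (s + \<epsilon>) powr b"]; simp)+

lemma qv_density_continuous:
  assumes "\<omega> \<in> space M" "0 < \<epsilon>"
  shows "continuous_on {0..t} (\<lambda>s. qv_density \<epsilon> s \<omega>)"
  unfolding qv_density_def using assms
  by (intro continuous_intros B_shift_continuous) auto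

lemma qv_density_set_integrable:
  "\<omega> \<in> space M \<Longrightarrow> 0 < \<epsilon> \<Longrightarrow> set_integrable lborel {0..t} (\<lambda>s. qv_density \<epsilon> s \<omega>)"
  by (intro borel_integrable_atLeastAtMost' qv_density_continuous)

lemma limit_density_set_integrable: "set_integrable lborel {0..t} limit_density"
  unfolding limit_density_def[abs_def]
  by (intro set_integrable_mult_right powr_set_integrable ab_gt)

text \<open>
  The hypotheses of \<open>random_integral_moments_tendsto\<close> are checked along an arbitrary sequence
  \<open>\<epsilon>\<^sub>n \<longrightarrow> 0\<close> in \<open>(0, 1)\<close>.  The majorant is a multiple of \<open>s\<^sup>a\<^sup>+\<^sup>b + (t + 1)\<^sup>a\<^sup>+\<^sup>b\<close>: its two terms dominate
  \<open>(s + \<epsilon>)\<^sup>a\<^sup>+\<^sup>b\<close> for negative and nonnegative \<open>a + b\<close> respectively.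
\<close>

lemma qv_density_integral_L2_tendsto:
  assumes t: "0 \<le> t"
  shows "((\<lambda>\<epsilon>. \<integral>\<^sup>+\<omega>. ennreal (((LBINT s:{0..t}. qv_density \<epsilon> s \<omega>) - (LBINT s:{0..t}. limit_density s))\<^sup>2) \<partial>M)
    \<longlongrightarrow> 0) (at_right 0)"
proof (rule tendsto_at_right_sequentially[of 0 1])
  fix e :: "nat \<Rightarrow> real"
  assume e: "\<And>n. 0 < e n" "\<And>n. e n < 1" "e \<longlonglongrightarrow> 0"
  define Z where "Z n \<omega> = (LBINT s:{0..t}. qv_density (e n) s \<omega>)" for n \<omega>
  define F where "F = (LBINT s:{0..t}. limit_density s)"
  define H where "H n s \<omega> = ennreal (indicator {0..t} s * qv_density (e n) s \<omega>)" for n s \<omega>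
  define h where "h s = ennreal (indicator {0..t} s * limit_density s)" for s
  define C where "C = kappa a b * (1 + a + b) * max 1 (2 powr a)"
  define D0 where "D0 s = indicator {0..t} s * (C * (s powr (a + b) + (t + 1) powr (a + b)))" for s :: real
  have C: "0 \<le> C" using kappa_pos ab_gt by (simp add: C_def le_max_iff_disj)
  have D0: "0 \<le> D0 s" for s using C by (simp add: D0_def)
  have H0: "0 \<le> indicator {0..t} s * qv_density (e n) s \<omega>" for n s \<omega>
    by (simp add: qv_density_nonneg)
  have ZH: "ennreal (Z n \<omega>) = (\<integral>\<^sup>+s. H n s \<omega> \<partial>lborel)" if "\<omega> \<in> space M" for n \<omega>
    unfolding Z_def H_def set_lebesgue_integral_def real_scaleR_def
    using qv_density_set_integrable[OF that e(1), of t n] H0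
    by (intro nn_integral_eq_integral[symmetric]) (auto simp: set_integrable_def)
  have Fh: "ennreal F = (\<integral>\<^sup>+s. h s \<partial>lborel)"
    unfolding F_def h_def set_lebesgue_integral_def real_scaleR_def
    using limit_density_set_integrable[of t]
    by (intro nn_integral_eq_integral[symmetric]) (auto simp: set_integrable_def limit_density_nonneg)
  have mean: "(\<integral>\<^sup>+\<omega>. H n s \<omega> \<partial>M) = ennreal (indicator {0..t} s * expectation (qv_density (e n) s))" for n s
  proof (cases "s \<in> {0..t}")
    case True
    then show ?thesis
      unfolding H_def using qv_density_integrable[OF e(1), of s n]
      by (simp add: nn_integral_eq_integral qv_density_nonneg)
  qed (simp add: H_def)
  have corr: "(\<integral>\<^sup>+\<omega>. H n s \<omega> * H n r \<omega> \<partial>M) = ennreal (indicator {0..t} s * indicator {0..t} r *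
      expectation (\<lambda>\<omega>. qv_density (e n) s \<omega> * qv_density (e n) r \<omega>))" for n s r
  proof (cases "s \<in> {0..t} \<and> r \<in> {0..t}")
    case True
    then show ?thesis
      unfolding H_def using qv_density_product_integrable[OF e(1), of s r n]
      by (simp add: nn_integral_eq_integral qv_density_nonneg ennreal_mult[symmetric])
  qed (auto simp: H_def)
  have mean_le: "expectation (qv_density (e n) s) \<le> D0 s" if s: "0 < s" "s \<le> t" for n s
  proof -
    have "(s + e n) powr (a + b) \<le> s powr (a + b) + (t + 1) powr (a + b)"
    proof (cases "a + b \<ge> 0")
      case True
      have "(s + e n) powr (a + b) \<le> (t + 1) powr (a + b)"
        using s e(1,2)[of n] True by (intro powr_mono2) auto
      then show ?thesis using powr_ge_zero[of s "a + b"] by linarith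
    next
      case False
      have "(s + e n) powr (a + b) \<le> s powr (a + b)"
        using s e(1)[of n] False by (intro powr_mono2') auto
      then show ?thesis using powr_ge_zero[of "t + 1" "a + b"] by linarith
    qed
    then have "C * (s + e n) powr (a + b) \<le> D0 s" using C s by (simp add: D0_def mult_left_mono)
    then show ?thesis using qv_density_mean_le[OF e(1), of s n] s by (simp add: C_def)
  qed
  have nonzero: "AE s in lborel. s \<noteq> (r :: real)" for r by (rule AE_lborel_singleton)
  have D_int: "set_integrable lborel {0..t} (\<lambda>s. C * (s powr (a + b) + (t + 1) powr (a + b)))"
    by (intro set_integrable_mult_right set_integral_add(1) powr_set_integrable ab_gt borel_integrable_atLeastAtMost')
       (rule continuous_on_const)
  have H_meas: "(\<lambda>p. H n (fst p) (snd p)) \<in> borel_measurable (lborel \<Otimes>\<^sub>M M)" for n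
    using qv_density_measurable(1)[OF e(1), of t n] unfolding H_def by (simp add: split_beta')
  have h_meas: "h \<in> borel_measurable lborel"
    unfolding h_def limit_density_def by measurable
  have D_meas: "(\<lambda>s. ennreal (D0 s)) \<in> borel_measurable lborel"
    unfolding D0_def by measurable
  have "(\<integral>\<^sup>+s. ennreal (D0 s) \<partial>lborel) = ennreal (LBINT s. D0 s)"
    using D_int D0 by (intro nn_integral_eq_integral) (auto simp: set_integrable_def D0_def[abs_def])
  then have D_fin: "(\<integral>\<^sup>+s. ennreal (D0 s) \<partial>lborel) < \<infinity>" by simp
  have D_top: "AE s in lborel. ennreal (D0 s) < \<infinity>" by simp
  have mean_lim: "AE s in lborel. (\<lambda>n. \<integral>\<^sup>+\<omega>. H n s \<omega> \<partial>M) \<longlonglongrightarrow> h s"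
    using nonzero[of 0]
  proof eventually_elim
    case (elim s)
    show ?case unfolding mean h_def
      using qv_density_mean_tendsto[OF e(1,3), of s] elim
      by (intro tendsto_ennrealI) (cases "s \<in> {0..t}"; auto)
  qed
  have mean_bd: "AE s in lborel. \<forall>n. (\<integral>\<^sup>+\<omega>. H n s \<omega> \<partial>M) \<le> ennreal (D0 s)"
    using nonzero[of 0]
  proof eventually_elim
    case (elim s)
    show ?case unfolding mean
      using mean_le[of s] elim D0[of s] by (auto intro!: ennreal_leI simp: indicator_def)
  qed
  have corr_lim: "AE s in lborel. AE r in lborel. (\<lambda>n. \<integral>\<^sup>+\<omega>. H n s \<omega> * H n r \<omega> \<partial>M) \<longlonglongrightarrow> h s * h r"
    using nonzero[of 0]
  proof eventually_elim
    case (elim s)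
    note s = elim
    show ?case using nonzero[of 0] nonzero[of s]
    proof eventually_elim
      case (elim r)
      have "h s * h r = ennreal (indicator {0..t} s * indicator {0..t} r * (limit_density s * limit_density r))"
        unfolding h_def by (simp add: ennreal_mult[symmetric] limit_density_nonneg mult_ac)
      then show ?case unfolding corr
        using qv_density_product_mean_tendsto[OF e(1,3), of s r] elim s
        by (simp only:, intro tendsto_ennrealI) (cases "s \<in> {0..t} \<and> r \<in> {0..t}"; auto)
    qed
  qed
  have corr_bd: "AE s in lborel. AE r in lborel. \<forall>n. (\<integral>\<^sup>+\<omega>. H n s \<omega> * H n r \<omega> \<partial>M) \<le> ennreal 3 * (ennreal (D0 s) * ennreal (D0 r))"
    using nonzero[of 0]
  proof eventually_elim
    case (elim s)
    note s = elim
    show ?case using nonzero[of 0]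
    proof eventually_elim
      case (elim r)
      show ?case
      proof
        fix n
        have "indicator {0..t} s * indicator {0..t} r * expectation (\<lambda>\<omega>. qv_density (e n) s \<omega> * qv_density (e n) r \<omega>)
            \<le> 3 * (D0 s * D0 r)"
        proof (cases "s \<in> {0..t} \<and> r \<in> {0..t}")
          case True
          have m0: "0 \<le> expectation (qv_density (e n) x)" for x
            by (rule Bochner_Integration.integral_nonneg) (rule qv_density_nonneg)
          have "expectation (qv_density (e n) s) * expectation (qv_density (e n) r) \<le> D0 s * D0 r"
            using True s elim by (intro mult_mono mean_le m0 D0) auto
          then show ?thesis using qv_density_product_mean_le[OF e(1), of s r n] True by simp
        next
          case False
          then show ?thesis using D0[of s] D0[of r] by auto
        qed
        then show "(\<integral>\<^sup>+\<omega>. H n s \<omega> * H n r \<omega> \<partial>M) \<le> ennreal 3 * (ennreal (D0 s) * ennreal (D0 r))"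
          unfolding corr using D0 by (simp add: ennreal_mult[symmetric] ennreal_leI flip: ennreal_numeral)
      qed
    qed
  qed
  note moments = random_integral_moments_tendsto[OF lborel.sigma_finite_measure_axioms
      H_meas h_meas D_meas D_fin mean_lim mean_bd D_top corr_lim corr_bd]
  have "(\<lambda>n. \<integral>\<^sup>+\<omega>. ennreal ((Z n \<omega> - F)\<^sup>2) \<partial>M) \<longlonglongrightarrow> 0"
  proof (rule squared_deviation_tendsto_zero)
    show "Z n \<in> borel_measurable M" for n
      unfolding Z_def[abs_def] by (rule qv_density_measurable(2)[OF e(1)])
    show "0 \<le> Z n \<omega>" for n \<omega>
      unfolding Z_def set_lebesgue_integral_def
      by (rule Bochner_Integration.integral_nonneg) (simp add: qv_density_nonneg)
    show "0 \<le> F"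
      unfolding F_def set_lebesgue_integral_def
      by (rule Bochner_Integration.integral_nonneg) (simp add: limit_density_nonneg)
    show "(\<lambda>n. \<integral>\<^sup>+\<omega>. Z n \<omega> \<partial>M) \<longlonglongrightarrow> ennreal F"
      using moments(1) by (simp add: ZH Fh cong: nn_integral_cong)
    show "(\<lambda>n. \<integral>\<^sup>+\<omega>. ennreal (Z n \<omega>) * ennreal (Z n \<omega>) \<partial>M) \<longlonglongrightarrow> ennreal F * ennreal F"
      using moments(2) by (simp add: ZH Fh cong: nn_integral_cong)
  qed
  then show "(\<lambda>n. \<integral>\<^sup>+\<omega>. ennreal (((LBINT s:{0..t}. qv_density (e n) s \<omega>) - (LBINT s:{0..t}. limit_density s))\<^sup>2) \<partial>M)
      \<longlonglongrightarrow> 0"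
    by (simp add: Z_def F_def)
qed simp

section \<open>The generalized quadratic covariation\<close>

lemma J_eps_shift:
  "J_eps a b B \<epsilon> f t \<omega> = (LBINT s:{0..t}. (1 + a + b) / \<epsilon> powr (1 + b) *
     ((f (B (s + 2 * \<epsilon>) \<omega>) - f (B (s + \<epsilon>) \<omega>)) * (B (s + 2 * \<epsilon>) \<omega> - B (s + \<epsilon>) \<omega>) * (s + \<epsilon>) powr b))"
proof -
  let ?k = "\<lambda>s. (f (B (s + \<epsilon>) \<omega>) - f (B s \<omega>)) * (B (s + \<epsilon>) \<omega> - B s \<omega>) * s powr b"
  have ind: "indicator {\<epsilon>..t + \<epsilon>} (\<epsilon> + s) = (indicator {0..t} s :: real)" for s
    by (auto simp: indicator_def)
  have "(LBINT s:{\<epsilon>..t + \<epsilon>}. ?k s) = (LBINT s:{0..t}. ?k (\<epsilon> + s))"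
    using lborel_integral_real_affine[of 1 "\<lambda>s. indicator {\<epsilon>..t + \<epsilon>} s *\<^sub>R ?k s" \<epsilon>]
    by (simp only: set_lebesgue_integral_def ind abs_one scaleR_one mult_1)
  moreover have "\<epsilon> + s + \<epsilon> = s + 2 * \<epsilon>" "\<epsilon> + s = s + \<epsilon>" for s :: real by auto
  ultimately show ?thesis unfolding J_eps_def set_integral_mult_right by (simp only:)
qed

text \<open>
  The deterministic half: for a single continuous path, convergence of \<open>\<integral> H\<^sub>\<epsilon>\<close> at the grid points gives
  uniform convergence of \<open>J\<^sub>\<epsilon>(f, \<cdot>)\<close>.  The integrand of \<open>J\<^sub>\<epsilon>(f, t)\<close> differs from \<open>f'(B\<^sub>s) H\<^sub>\<epsilon>(s)\<close> by at
  most \<open>\<eta> H\<^sub>\<epsilon>(s)\<close>, and the total mass of \<open>H\<^sub>\<epsilon>\<close> stays bounded.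
\<close>

lemma J_eps_pathwise_uniform_limit:
  assumes \<omega>: "\<omega> \<in> space M" and e: "\<And>n. 0 < e n" "e \<longlonglongrightarrow> 0" and T: "0 \<le> T"
    and conv: "\<And>i m. i \<le> m \<Longrightarrow> 0 < m \<Longrightarrow>
      (\<lambda>n. LBINT s:{0..T * real i / real m}. qv_density (e n) s \<omega>) \<longlonglongrightarrow> (LBINT s:{0..T * real i / real m}. limit_density s)"
    and f: "\<And>y. (f has_real_derivative f' y) (at y)" and f': "continuous_on UNIV f'"
  shows "uniform_limit {0..T} (\<lambda>n t. J_eps a b B (e n) f t \<omega>)
    (\<lambda>t. LBINT s:{0..t}. f' (B s \<omega>) * limit_density s) sequentially"
proof (rule uniform_limitI)
  fix \<delta> :: real assume \<delta>: "\<delta> > 0"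
  let ?g = "\<lambda>s. f' (B s \<omega>)" and ?H = "\<lambda>n s. qv_density (e n) s \<omega>"
  have cf: "continuous_on UNIV f" using f DERIV_continuous_on by blast
  have Bc: "continuous_on {0..T} (\<lambda>s. B s \<omega>)" using B_shift_continuous[OF \<omega>, of 0 T] by simp
  have g: "continuous_on {0..T} ?g" by (rule continuous_on_compose2[OF f' Bc]) auto
  define FT where "FT = (LBINT s:{0..T}. limit_density s)"
  have FT: "0 \<le> FT"
    unfolding FT_def set_lebesgue_integral_def
    by (rule Bochner_Integration.integral_nonneg) (simp add: limit_density_nonneg)
  define \<eta> where "\<eta> = \<delta> / (2 * (FT + 1))"
  have \<eta>: "\<eta> > 0" "\<eta> * (FT + 1) = \<delta> / 2" using \<delta> FT by (auto simp: \<eta>_def field_simps)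
  obtain d where d: "d > 0" "\<And>\<epsilon> s. 0 < \<epsilon> \<Longrightarrow> \<epsilon> < d \<Longrightarrow> s \<in> {0..T} \<Longrightarrow>
      \<bar>f (B (s + 2 * \<epsilon>) \<omega>) - f (B (s + \<epsilon>) \<omega>) - ?g s * (B (s + 2 * \<epsilon>) \<omega> - B (s + \<epsilon>) \<omega>)\<bar>
      \<le> \<eta> * \<bar>B (s + 2 * \<epsilon>) \<omega> - B (s + \<epsilon>) \<omega>\<bar>"
    using increments_uniformly_linear[OF f f' B_continuous[OF \<omega>] T \<eta>(1)] by blast
  have "uniform_limit {0..T} (\<lambda>n t. LBINT s:{0..t}. ?g s * ?H n s) (\<lambda>t. LBINT s:{0..t}. ?g s * limit_density s) sequentially"
    by (intro uniform_limit_weighted_integrals T g conv qv_density_set_integrable \<omega> e(1) qv_density_nonneg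
        limit_density_set_integrable limit_density_nonneg set_lborel_integral_continuous_upper)
  from uniform_limitD[OF this, of "\<delta> / 2"] \<delta>
  have main: "\<forall>\<^sub>F n in sequentially. \<forall>t\<in>{0..T}. dist (LBINT s:{0..t}. ?g s * ?H n s) (LBINT s:{0..t}. ?g s * limit_density s) < \<delta> / 2"
    by simp
  have "(\<lambda>n. LBINT s:{0..T}. ?H n s) \<longlonglongrightarrow> FT" using conv[of 1 1] by (simp add: FT_def)
  then have mass: "\<forall>\<^sub>F n in sequentially. (LBINT s:{0..T}. ?H n s) < FT + 1" by (rule order_tendstoD) simp
  have small: "\<forall>\<^sub>F n in sequentially. e n < d" by (rule order_tendstoD(2)[OF e(2) d(1)])
  show "\<forall>\<^sub>F n in sequentially. \<forall>t\<in>{0..T}. dist (J_eps a b B (e n) f t \<omega>) (LBINT s:{0..t}. ?g s * limit_density s) < \<delta>"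
    using main mass small
  proof eventually_elim
    case (elim n)
    let ?\<epsilon> = "e n"
    define q where "q = (1 + a + b) / ?\<epsilon> powr (1 + b)"
    define j where "j s = q * ((f (B (s + 2 * ?\<epsilon>) \<omega>) - f (B (s + ?\<epsilon>) \<omega>)) * (B (s + 2 * ?\<epsilon>) \<omega> - B (s + ?\<epsilon>) \<omega>) * (s + ?\<epsilon>) powr b)" for s
    have q: "0 \<le> q" using ab_gt by (simp add: q_def)
    note H_int = qv_density_set_integrable[OF \<omega> e(1), of _ n]
    have gH_int: "set_integrable lborel {0..T} (\<lambda>s. ?g s * ?H n s)"
      by (rule continuous_times_set_integrable[OF g H_int])
    have fB: "continuous_on {0..T} (\<lambda>s. f (B (s + c) \<omega>))" if "0 \<le> c" for c
      by (rule continuous_on_compose2[OF cf B_shift_continuous[OF \<omega> that]]) auto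
    have j_int: "set_integrable lborel {0..T} j"
      unfolding j_def using e(1)[of n]
      by (intro borel_integrable_atLeastAtMost' continuous_intros fB B_shift_continuous \<omega>) auto
    have pointwise: "\<bar>j s - ?g s * ?H n s\<bar> \<le> \<eta> * ?H n s" if s: "s \<in> {0..T}" for s
    proof -
      let ?x = "B (s + 2 * ?\<epsilon>) \<omega> - B (s + ?\<epsilon>) \<omega>"
      have "j s - ?g s * ?H n s = q * (s + ?\<epsilon>) powr b * ?x *
          (f (B (s + 2 * ?\<epsilon>) \<omega>) - f (B (s + ?\<epsilon>) \<omega>) - ?g s * ?x)"
        unfolding j_def qv_density_def q_def[symmetric] power2_eq_square by algebra
      also have "\<bar>\<dots>\<bar> = (q * (s + ?\<epsilon>) powr b * \<bar>?x\<bar>) *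
          \<bar>f (B (s + 2 * ?\<epsilon>) \<omega>) - f (B (s + ?\<epsilon>) \<omega>) - ?g s * ?x\<bar>"
        using q by (simp add: abs_mult)
      also have "\<dots> \<le> (q * (s + ?\<epsilon>) powr b * \<bar>?x\<bar>) * (\<eta> * \<bar>?x\<bar>)"
        using d(2)[OF e(1) elim(3) s] q by (intro mult_left_mono) auto
      also have "\<dots> = \<eta> * (q * (s + ?\<epsilon>) powr b * (\<bar>?x\<bar> * \<bar>?x\<bar>))" by (simp only: mult_ac)
      also have "\<dots> = \<eta> * ?H n s"
        by (simp add: qv_density_def q_def[symmetric] power2_eq_square)
      finally show ?thesis .
    qed
    show ?case
    proof
      fix t assume t: "t \<in> {0..T}"
      have sub: "{0..t} \<subseteq> {0..T}" using t by auto
      note i = set_integrable_subset[OF j_int _ sub] set_integrable_subset[OF gH_int _ sub]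
      have "\<bar>(LBINT s:{0..t}. j s) - (LBINT s:{0..t}. ?g s * ?H n s)\<bar> = \<bar>LBINT s:{0..t}. j s - ?g s * ?H n s\<bar>"
        using i by (simp add: set_integral_diff)
      also have "\<dots> \<le> (LBINT s:{0..t}. \<bar>j s - ?g s * ?H n s\<bar>)"
        using integral_abs_bound[of lborel "\<lambda>s. indicator {0..t} s *\<^sub>R (j s - ?g s * ?H n s)"]
        by (simp add: set_lebesgue_integral_def abs_mult)
      also have "\<dots> \<le> (LBINT s:{0..t}. \<eta> * ?H n s)"
        using i sub pointwise H_int
        by (intro set_integral_mono set_integrable_abs set_integral_diff(1) set_integrable_mult_right) auto
      also have "\<dots> = \<eta> * (LBINT s:{0..t}. ?H n s)" by simp
      also have "\<dots> \<le> \<eta> * (LBINT s:{0..T}. ?H n s)"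
        unfolding set_lebesgue_integral_def using \<eta>(1) H_int sub
        by (intro mult_left_mono integral_mono) (auto simp: set_integrable_def indicator_def qv_density_nonneg)
      also have "\<dots> \<le> \<eta> * (FT + 1)" using elim(2) \<eta>(1) by (intro mult_left_mono) auto
      finally have "\<bar>(LBINT s:{0..t}. j s) - (LBINT s:{0..t}. ?g s * ?H n s)\<bar> \<le> \<delta> / 2" using \<eta>(2) by simp
      moreover have "J_eps a b B ?\<epsilon> f t \<omega> = (LBINT s:{0..t}. j s)"
        unfolding J_eps_shift j_def q_def ..
      moreover have "dist (LBINT s:{0..t}. ?g s * ?H n s) (LBINT s:{0..t}. ?g s * limit_density s) < \<delta> / 2"
        using elim(1) t by blast
      ultimately show "dist (J_eps a b B ?\<epsilon> f t \<omega>) (LBINT s:{0..t}. ?g s * limit_density s) < \<delta>"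
        unfolding dist_real_def by linarith
    qed
  qed
qed

text \<open>
  The variables \<open>W \<epsilon> k\<close> handed to \<open>vanishing_probability_by_sequences\<close> are the squared deviations of \<open>\<integral> H\<^sub>\<epsilon>\<close> at the countably many grid points
  \<open>T i / m\<close>, enumerated through the pairing function; indices that encode no grid point refer to time \<open>0\<close>.
\<close>

lemma J_eps_ucp_limit:
  assumes f: "\<And>y. (f has_real_derivative f' y) (at y)" and f': "continuous_on UNIV f'"
  shows "ucp_limit M (\<lambda>\<epsilon> t \<omega>. J_eps a b B \<epsilon> f t \<omega>) (\<lambda>t \<omega>. LBINT s:{0..t}. f' (B s \<omega>) * limit_density s)"
  unfolding ucp_limit_def
proof (intro allI impI conjI)
  fix T \<delta> :: real assume T: "0 \<le> T" and \<delta>: "0 < \<delta>"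
  let ?Y = "\<lambda>t \<omega>. LBINT s:{0..t}. f' (B s \<omega>) * limit_density s"
  define E where "E \<epsilon> = {\<omega> \<in> space M. \<exists>t\<in>{0..T}. \<bar>J_eps a b B \<epsilon> f t \<omega> - ?Y t \<omega>\<bar> > \<delta>}" for \<epsilon>
  have cf: "continuous_on UNIV f" using f DERIV_continuous_on by blast
  note [measurable] = borel_measurable_continuous_onI[OF cf] borel_measurable_continuous_onI[OF f']
  have E: "E \<epsilon> \<in> events" if \<epsilon>: "\<epsilon> > 0" for \<epsilon>
    unfolding E_def
  proof (rule continuous_exceedance_measurable)
    fix t assume t: "t \<in> {0..T}"
    have "(\<lambda>\<omega>. J_eps a b B \<epsilon> f t \<omega>) \<in> borel_measurable M"
      unfolding J_eps_shift using \<epsilon>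
      by (intro B_functional_integral_measurable(2)[where c = "2 * \<epsilon>" and c' = \<epsilon> and
        \<Psi> = "\<lambda>s y z. (1 + a + b) / \<epsilon> powr (1 + b) * ((f y - f z) * (y - z) * (s + \<epsilon>) powr b)"]) auto
    moreover have "?Y t \<in> borel_measurable M"
      using B_functional_integral_measurable(2)[where c = 0 and c' = 0 and \<Psi> = "\<lambda>s y z. f' y * limit_density s"]
      by (simp add: limit_density_def)
    ultimately show "(\<lambda>\<omega>. J_eps a b B \<epsilon> f t \<omega> - ?Y t \<omega>) \<in> borel_measurable M" by (rule borel_measurable_diff)
  next
    fix \<omega> assume \<omega>: "\<omega> \<in> space M"
    have fB: "continuous_on {0..T} (\<lambda>s. f (B (s + c) \<omega>))" if "0 \<le> c" for c
      by (rule continuous_on_compose2[OF cf B_shift_continuous[OF \<omega> that]]) auto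
    have "continuous_on {0..T} (\<lambda>t. J_eps a b B \<epsilon> f t \<omega>)"
      unfolding J_eps_shift using \<epsilon>
      by (intro set_lborel_integral_continuous_upper borel_integrable_atLeastAtMost' continuous_intros
          fB B_shift_continuous \<omega>) auto
    moreover have "continuous_on {0..T} (\<lambda>s. f' (B s \<omega>))"
      using B_shift_continuous[OF \<omega>, of 0 T] by (intro continuous_on_compose2[OF f']) auto
    then have "continuous_on {0..T} (\<lambda>t. ?Y t \<omega>)"
      by (intro set_lborel_integral_continuous_upper continuous_times_set_integrable limit_density_set_integrable)
    ultimately show "continuous_on {0..T} (\<lambda>t. J_eps a b B \<epsilon> f t \<omega> - ?Y t \<omega>)" by (rule continuous_on_diff)
  qed
  show "\<forall>\<^sub>F \<epsilon> in at_right 0. {\<omega> \<in> space M. \<exists>t\<in>{0..T}. \<delta> < \<bar>J_eps a b B \<epsilon> f t \<omega> - ?Y t \<omega>\<bar>} \<in> events"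
    using eventually_at_right_less[of "0 :: real"] E unfolding E_def by (auto elim: eventually_mono)
  define p where "p k = (case prod_decode k of (i, m) \<Rightarrow> if i \<le> m \<and> 0 < m then T * real i / real m else 0)" for k
  have p: "0 \<le> p k" for k using T by (auto simp: p_def split: prod.split)
  define W where "W \<epsilon> k \<omega> = ((LBINT s:{0..p k}. qv_density \<epsilon> s \<omega>) - (LBINT s:{0..p k}. limit_density s))\<^sup>2" for \<epsilon> k \<omega>
  have "((\<lambda>\<epsilon>. prob (E \<epsilon>)) \<longlongrightarrow> 0) (at_right 0)"
  proof (rule vanishing_probability_by_sequences[where W = W])
    show "W \<epsilon> k \<in> borel_measurable M" if "\<epsilon> > 0" for \<epsilon> k
      using qv_density_measurable(2)[OF that, of "p k"] unfolding W_def[abs_def] by simp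
    show "0 \<le> W \<epsilon> k \<omega>" for \<epsilon> k \<omega> by (simp add: W_def)
    show "((\<lambda>\<epsilon>. \<integral>\<^sup>+\<omega>. W \<epsilon> k \<omega> \<partial>M) \<longlongrightarrow> 0) (at_right 0)" for k
      using qv_density_integral_L2_tendsto[OF p[of k]] by (simp add: W_def)
    show "\<epsilon> > 0 \<Longrightarrow> E \<epsilon> \<in> events" for \<epsilon> by (rule E)
    fix e :: "nat \<Rightarrow> real" and \<omega>
    assume e: "\<And>n. 0 < e n" "e \<longlonglongrightarrow> 0" and \<omega>: "\<omega> \<in> space M" and W: "\<And>k. (\<lambda>n. W (e n) k \<omega>) \<longlonglongrightarrow> 0"
    have conv: "(\<lambda>n. LBINT s:{0..T * real i / real m}. qv_density (e n) s \<omega>) \<longlonglongrightarrow> (LBINT s:{0..T * real i / real m}. limit_density s)"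
      if "i \<le> m" "0 < m" for i m
    proof -
      have "p (prod_encode (i, m)) = T * real i / real m" using that by (simp add: p_def)
      then have "(\<lambda>n. ((LBINT s:{0..T * real i / real m}. qv_density (e n) s \<omega>) - (LBINT s:{0..T * real i / real m}. limit_density s))\<^sup>2) \<longlonglongrightarrow> 0"
        using W[of "prod_encode (i, m)"] by (simp add: W_def)
      from tendsto_real_sqrt[OF this] have "(\<lambda>n. \<bar>(LBINT s:{0..T * real i / real m}. qv_density (e n) s \<omega>) - (LBINT s:{0..T * real i / real m}. limit_density s)\<bar>) \<longlonglongrightarrow> 0"
        by simp
      then show ?thesis by (rule LIM_zero_cancel[OF tendsto_rabs_zero_cancel])
    qed
    have "\<forall>\<^sub>F n in sequentially. \<forall>t\<in>{0..T}. dist (J_eps a b B (e n) f t \<omega>) (?Y t \<omega>) < \<delta>"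
      by (rule uniform_limitD[OF J_eps_pathwise_uniform_limit[OF \<omega> e T conv f f'] \<delta>])
    then show "\<forall>\<^sub>F n in sequentially. \<omega> \<notin> E (e n)"
      by eventually_elim (auto simp: E_def dist_real_def not_less intro: less_imp_le)
  qed
  then show "((\<lambda>\<epsilon>. prob {\<omega> \<in> space M. \<exists>t\<in>{0..T}. \<delta> < \<bar>J_eps a b B \<epsilon> f t \<omega> - ?Y t \<omega>\<bar>}) \<longlongrightarrow> 0) (at_right 0)"
    unfolding E_def .
qed

end

theorem corollary4p1:
  fixes M :: "'a measure" and a b :: real and B :: "real \<Rightarrow> 'a \<Rightarrow> real" and f :: "real \<Rightarrow> real"
  assumes "prob_space M"
    and "a > -1" and "\<bar>b\<bar> < 1" and "\<bar>b\<bar> < 1 + a"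
    and "weighted_fbm M a b B"
    and "f C1_differentiable_on UNIV"
  shows "has_gen_quad_covariation M a b B f
           (\<lambda>t \<omega>. kappa a b *
              (LBINT s:{0..t}. deriv f (B s \<omega>) * ((1 + a + b) * s powr (a + b))))"
proof -
  interpret wfbm M a b B
    using assms by (simp add: wfbm_def wfbm_axioms_def)
  obtain f' where f': "\<And>y. (f has_vector_derivative f' y) (at y)" "continuous_on UNIV f'"
    using assms(6) by (auto simp: C1_differentiable_on_def)
  then have f: "\<And>y. (f has_real_derivative f' y) (at y)"
    by (simp add: has_real_derivative_iff_has_vector_derivative)
  then have [simp]: "deriv f = f'" by (auto simp: DERIV_imp_deriv)
  have "(\<lambda>t \<omega>. kappa a b * (LBINT s:{0..t}. deriv f (B s \<omega>) * ((1 + a + b) * s powr (a + b))))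
      = (\<lambda>t \<omega>. LBINT s:{0..t}. f' (B s \<omega>) * limit_density s)"
    unfolding set_integral_mult_right[symmetric] by (simp add: limit_density_def mult_ac)
  then show ?thesis
    unfolding has_gen_quad_covariation_def using J_eps_ucp_limit[OF f f'(2)] by simp
qed

end
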